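(* For every triangle $K\in\mathcal T_h$ with edge lengths $l_K^{(1)},l_K^{(2)},l_K^{(3)}$ set $\bar l_K=\frac13\sum_il_K^{(i)}$, $$\hat l_K=\sqrt{(l_K^{(1)})^2+(l_K^{(2)})^2+(l_K^{(3)})^2-\tfrac23\big(l_K^{(1)}l_K^{(2)}+l_K^{(2)}l_K^{(3)}+l_K^{(3)}l_K^{(1)}\big)},\quad w_i=\frac{2l_K^{(i)}}{9\bar l_K+3\hat l_K},\quad\mathcal C_{K,2}=\frac{2}{9\bar l_K+3\hat l_K}.$$ (Systems.) Consider a hyperbolic system of conservation laws $\bm u_t+\nabla\cdot\bm F(\bm u)=\bm 0$ with invariant region $\mathcal G$, satisfying the weak LF property. Suppose that the piecewise $\mathbb P^2$ solution $\bm u_h^n$ at time $t^n$ satisfies $\bm u^{\rm int}_{i,\nu},\bm u^{\rm ext}_{i,\nu},\bm u_K^*\in\mathcal G$ for all $i,\nu,K$. Then the $\mathbb P^2$-based scheme with the LF flux and viscosity coefficient $\alpha\ge\alpha^{\rm wLF}$ is bound-preserving (BP), i.e. $\bar{\bm u}_K^{n+1}\in\mathcal G$ for all $K$, under the CFL condition $$\alpha\frac{\Delta t}{|K|}\le\mathcal C_{K,2}\qquad\forall K\in\mathcal T_h.$$ (Scalar.) For a scalar conservation law $u_t+\nabla\cdot\bm F(u)=0$ with $\mathcal G=[u_{\min},u_{\max}]$, the same conclusion holds under the same CFL condition, with the analogous hypothesis on $u_h^n$ and with $\alpha\ge\alpha^{\rm LF}$. Moreover, this BP CFL condition cannot be improved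 by selecting another convex decomposition: for every $K$ and every convex decomposition on $K$ feasible for $\mathbb P^2$ with edge weights $\tilde w_i$, $\min_i\tilde w_i/l_K^{(i)}\le\mathcal C_{K,2}$.
   Context: **Mesh.** $\mathcal T_h$ is a triangulation of $\Omega\subset\mathbb R^2$; for $K\in\mathcal T_h$, $e_K^{(i)}$ ($i=1,2,3$) are the edges, $l_K^{(i)}$ their lengths, $\bm n_K^{(i)}$ the outward unit normals, $|K|$ the area. $\bm F=(\bm f_1,\bm f_2)$, $\bm F(\bm u)\cdot\bm n=n^1\bm f_1(\bm u)+n^2\bm f_2(\bm u)$. **Scheme.** $\bm u_h^n$ is polynomial of degree $\le k$ (here $k=2$) on each $K$, with cell averages $\bar{\bm u}_K^n$. $(x_K^{(i),\nu},y_K^{(i),\nu})$, $\omega_\nu^{\tt G}$, $\nu=1,\dots,Q$, are the nodes and weights of the $Q=k+1$ point Gauss quadrature on $e_K^{(i)}$, with $\sum_\nu\omega^{\tt G}_\nu=1$. $\bm u^{\rm int}_{i,\nu}$ and $\bm u^{\rm ext}_{i,\nu}$ are the values at this node of $\bm u_h^n$ from inside $K$ and from the neighbouring cell across $e_K^{(i)}$. The scheme (LF flux, forward Euler) is $$\bar{\bm u}_K^{n+1}=\bar{\bm u}_K^n-\frac{\Delta t}{2|K|}\sum_{i=1}^3l_K^{(i)}\sum_{\nu=1}^Q\omega_\nu^{\tt G}\big[\bm F(\bm u^{\rm int}_{i,\nu})\cdot\bm n_K^{(i)}+\bm F(\bm u^{\rm ext}_{i,\nu})\cdot\bm n_K^{(i)}+\alpha\bm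 u^{\rm int}_{i,\nu}-\alpha\bm u^{\rm ext}_{i,\nu}\big]$$ (and the same formula in the scalar case), and (here $\sum_iw_i<1$ always) $$\bm u_K^*=\frac{\bar{\bm u}_K^n-\sum_{i=1}^3w_i\sum_{\nu=1}^Q\omega_\nu^{\tt G}\bm u^{\rm int}_{i,\nu}}{1-\sum_{i=1}^3w_i}.$$ **Scalar case.** $u_{\min}$, $u_{\max}$ are the minimum and maximum of the initial datum, and $\alpha^{\rm LF}=\max|\bm F'(u_h(\bm x))\cdot\bm n_K^{(i)}|$ over $\bm x\in e_K^{(i)}$, $i\in\{1,2,3\}$, $K\in\mathcal T_h$ (both one-sided values of $u_h$ on the edges are included). **System case.** $\mathcal G=\{\bm u\in\mathbb R^d:g_j(\bm u)\succ0\ \forall j\in\mathbb J\cup\hat{\mathbb J}\}$, where $\succ$ means $>$ for $j\in\mathbb J$ and $\ge$ for $j\in\hat{\mathbb J}$. It is a standing assumption that $\mathcal G$ equals its GQL representation $$\mathcal G^\star=\{\bm u\in\mathbb R^d:(\bm u-\bm u^\star_j)\cdot\mathbf n^\star_j\succ0\ \ \forall\bm u^\star_j\in\mathcal S_j,\ \forall j\in\mathbb J\cup\hat{\mathbb J}\},$$ with $\mathbf n^\star_j=\nabla g_j(\bm u^\star_j)$, $\mathcal S_j=\partial\mathcal G\cap\partial\mathcal G_j$, $\mathcal G_j=\{\bm u:g_j(\bm u)\succ0\}$. *Weak LF property*: for any unit $\bm n\in\mathbb R^2$ and any $\bm u\in\mathcal G$ there exist $\tilde\alpha(\bm u,\bm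 n)>0$ and $\bm\zeta(\bm u^\star)\in\mathbb R^2$ ($\bm\zeta$ depending only on $\bm u^\star$, not on $\bm u,\bm n$) such that $$\tilde\alpha(\bm u,\bm n)(\bm u-\bm u^\star)\cdot\mathbf n^\star_j-(\bm F(\bm u)\cdot\bm n)\cdot\mathbf n_j^\star\succ\bm\zeta(\bm u^\star)\cdot\bm n\qquad\forall\bm u^\star\in\mathcal S_j,\ \forall j.$$ $\alpha^{\rm wLF}=\max\tilde\alpha(\bm u_h(\bm x),\bm n_K^{(i)})$ over $\bm x\in e_K^{(i)}$, $i\in\{1,2,3\}$, $K\in\mathcal T_h$ (both one-sided values included). **Feasible convex decomposition.** An identity $\frac1{|K|}\iint_Kp\,dx\,dy=\sum_{i=1}^3\frac{w_i}{l_K^{(i)}}\int_{e_K^{(i)}}p\,ds+\sum_{s=1}^S\omega_sp(\xi_s,\eta_s)$ is feasible for $\mathbb P^k$ (polynomials of total degree $\le k$) if it holds for all $p\in\mathbb P^k$, all weights $w_i,\omega_s$ are positive and sum to one, and all nodes $(\xi_s,\eta_s)$ lie in $K$.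
   Formalization: In the scalar case the maximum defining α^LF is taken, for each K and i, over all states in the interval spanned by the one-sided edge values of u_h on the boundary of K, not only over the values on e_K^(i); with the literal α^LF the claim is false. *)

theory Defs
  imports "HOL-Analysis.Analysis"
begin

section \<open>Triangles and meshes\<close>

text \<open>A cell is a triangle given by its three labelled vertices. Indices live in the cyclic type
  \<open>3\<close>: the edge with index \<open>i\<close> joins the vertices \<open>i\<close> and \<open>i + 1\<close>, and
  \<open>i + 2\<close> is the vertex opposite to it.\<close>

type_synonym cell = "real ^ 2 ^ 3"

definition region :: "cell \<Rightarrow> (real ^ 2) set" where
  "region K = convex hull (range (($) K))"

definition area :: "cell \<Rightarrow> real" where
  "area K = measure lebesgue (region K)"

definition edge :: "cell \<Rightarrow> 3 \<Rightarrow> (real ^ 2) set" where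
  "edge K i = closed_segment (K $ i) (K $ (i + 1))"

definition edge_len :: "cell \<Rightarrow> 3 \<Rightarrow> real" where
  "edge_len K i = dist (K $ i) (K $ (i + 1))"

definition edge_point :: "cell \<Rightarrow> 3 \<Rightarrow> real \<Rightarrow> real ^ 2" where
  "edge_point K i t = (1 - t) *\<^sub>R (K $ i) + t *\<^sub>R (K $ (i + 1))"

definition outward_normal :: "cell \<Rightarrow> 3 \<Rightarrow> real ^ 2" where
  "outward_normal K i = (THE n. norm n = 1 \<and> n \<bullet> (K $ (i + 1) - K $ i) = 0
                                 \<and> n \<bullet> (K $ (i + 2) - K $ i) < 0)"

text \<open>The constant \<^const>\<open>triangulation\<close> requires finitely many simplices that meet only in
  common faces.\<close>

definition mesh_of :: "cell set \<Rightarrow> (real ^ 2) set \<Rightarrow> bool" where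
  "mesh_of \<T> \<Omega> \<longleftrightarrow>
     triangulation (region ` \<T>) \<and> inj_on region \<T> \<and>
     (\<forall>K\<in>\<T>. \<not> collinear (range (($) K))) \<and> (\<Union>K\<in>\<T>. region K) = closure \<Omega>"

section \<open>Polynomials, convex decompositions and the proposed weights\<close>

definition polys :: "nat \<Rightarrow> (real ^ 2 \<Rightarrow> 'v::real_vector) set" where
  "polys k = {p. \<exists>c. \<forall>x. p x = (\<Sum>a\<le>k. \<Sum>b\<le>k - a. (x $ 1 ^ a * x $ 2 ^ b) *\<^sub>R c a b)}"

definition cell_avg :: "cell \<Rightarrow> (real ^ 2 \<Rightarrow> 'v::euclidean_space) \<Rightarrow> 'v" where
  "cell_avg K p = (1 / area K) *\<^sub>R integral (region K) p"

text \<open>Arc-length integral, in the affine parametrization of the edge over \<open>[0, 1]\<close>.\<close>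

definition edge_integral :: "cell \<Rightarrow> 3 \<Rightarrow> (real ^ 2 \<Rightarrow> real) \<Rightarrow> real" where
  "edge_integral K i p = edge_len K i * integral {0..1} (\<lambda>t. p (edge_point K i t))"

definition feasible_decomposition ::
  "nat \<Rightarrow> cell \<Rightarrow> (3 \<Rightarrow> real) \<Rightarrow> nat \<Rightarrow> (nat \<Rightarrow> real) \<Rightarrow> (nat \<Rightarrow> real ^ 2) \<Rightarrow> bool" where
  "feasible_decomposition k K w S \<omega> \<xi> \<longleftrightarrow>
     (\<forall>p\<in>polys k. cell_avg K p = (\<Sum>i\<in>UNIV. w i / edge_len K i * edge_integral K i p)
                                   + (\<Sum>s<S. \<omega> s * p (\<xi> s))) \<and>
     (\<forall>i. 0 < w i) \<and> (\<forall>s<S. 0 < \<omega> s) \<and> (\<Sum>i\<in>UNIV. w i) + (\<Sum>s<S. \<omega> s) = 1 \<and>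
     (\<forall>s<S. \<xi> s \<in> region K)"

definition l_bar :: "cell \<Rightarrow> real" where
  "l_bar K = 1 / 3 * (\<Sum>i\<in>UNIV. edge_len K i)"

definition l_hat :: "cell \<Rightarrow> real" where
  "l_hat K = sqrt ((\<Sum>i\<in>UNIV. (edge_len K i)\<^sup>2)
                   - 2 / 3 * (\<Sum>i\<in>UNIV. edge_len K i * edge_len K (i + 1)))"

definition edge_weight :: "cell \<Rightarrow> 3 \<Rightarrow> real" where
  "edge_weight K i = 2 * edge_len K i / (9 * l_bar K + 3 * l_hat K)"

definition cfl_const :: "cell \<Rightarrow> real" where
  "cfl_const K = 2 / (9 * l_bar K + 3 * l_hat K)"

section \<open>Three-point Gauss quadrature\<close>

text \<open>Nodes are given as parameters in \<open>[0, 1]\<close>; the weights are normalized to sum one.\<close>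

definition gauss_node :: "real ^ 3" where
  "gauss_node = vector [1 / 2 - sqrt 15 / 10, 1 / 2, 1 / 2 + sqrt 15 / 10]"

definition gauss_weight :: "real ^ 3" where
  "gauss_weight = vector [5 / 18, 4 / 9, 5 / 18]"

lemma gauss_exact:
  assumes "j \<le> 5"
  shows "(\<Sum>\<nu>\<in>UNIV. gauss_weight $ \<nu> * gauss_node $ \<nu> ^ j) = integral {0..1} (\<lambda>t. t ^ j)"
proof -
  define s :: real where "s = sqrt 15"
  have s2: "s * s = 15" by (simp add: s_def)
  have "((\<lambda>t. t ^ Suc j / Suc j) has_real_derivative t ^ j) (at t within {0..1})" for t :: real
    by (rule derivative_eq_intros refl | (cases j; simp add: divide_simps; simp add: algebra_simps))+
  then have "((\<lambda>t::real. t ^ j) has_integral (1 ^ Suc j / Suc j - 0 ^ Suc j / Suc j)) {0..1}"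
    by (intro fundamental_theorem_of_calculus)
      (auto simp flip: has_real_derivative_iff_has_vector_derivative)
  then have int: "integral {0..1} (\<lambda>t::real. t ^ j) = 1 / Suc j"
    by (simp add: integral_unique)
  have ss: "s * (s * x) = 15 * x" for x using s2 by (simp flip: mult.assoc)
  have p2: "(1 / 2 - s / 10) ^ 2 = 2 / 5 - s / 10" "(1 / 2 + s / 10) ^ 2 = 2 / 5 + s / 10"
    using s2 by (simp_all add: power2_eq_square algebra_simps)
  have step3: "x ^ 3 = x ^ 2 * x" and step4: "x ^ 4 = x ^ 3 * x" and step5: "x ^ 5 = x ^ 4 * x" for x :: real
    by (simp_all add: eval_nat_numeral)
  have p3: "(1 / 2 - s / 10) ^ 3 = 7 / 20 - 9 * s / 100" "(1 / 2 + s / 10) ^ 3 = 7 / 20 + 9 * s / 100"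
    by (simp_all only: step3 p2) (simp_all add: s2 ss field_simps)
  have p4: "(1 / 2 - s / 10) ^ 4 = 31 / 100 - 2 * s / 25" "(1 / 2 + s / 10) ^ 4 = 31 / 100 + 2 * s / 25"
    by (simp_all only: step4 p3) (simp_all add: s2 ss field_simps)
  have p5: "(1 / 2 - s / 10) ^ 5 = 11 / 40 - 71 * s / 1000" "(1 / 2 + s / 10) ^ 5 = 11 / 40 + 71 * s / 1000"
    by (simp_all only: step5 p4) (simp_all add: s2 ss field_simps)
  have "j \<in> {0, 1, 2, 3, 4, 5}" using assms by auto
  then show ?thesis
    unfolding int
    by (auto simp: gauss_node_def gauss_weight_def sum_3 vector_3 s_def[symmetric] p2 p3 p4 p5)
      (simp_all add: power_divide field_simps)
qed

definition gauss_point :: "cell \<Rightarrow> 3 \<Rightarrow> 3 \<Rightarrow> real ^ 2" where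
  "gauss_point K i \<nu> = edge_point K i (gauss_node $ \<nu>)"

section \<open>The scheme\<close>

text \<open>A discrete solution assigns to each cell \<open>K\<close> a polynomial \<open>u K\<close>; only its values on
  \<open>region K\<close> matter. The cell across an edge is unique in a triangulation if it exists. On an
  edge of the boundary of the domain the exterior value is taken from boundary data \<open>ub\<close>, which
  are arbitrary (prescribed values, or, for periodic conditions, traces taken from the cell on the
  opposite side).\<close>

type_synonym 'v discrete_fun = "cell \<Rightarrow> real ^ 2 \<Rightarrow> 'v"
type_synonym 'v boundary_data = "cell \<Rightarrow> 3 \<Rightarrow> real ^ 2 \<Rightarrow> 'v"

definition across :: "cell set \<Rightarrow> cell \<Rightarrow> 3 \<Rightarrow> cell \<Rightarrow> bool" where
  "across \<T> K i K' \<longleftrightarrow> K' \<in> \<T> \<and> K' \<noteq> K \<and> edge K i \<subseteq> region K'"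

definition ext_value ::
  "cell set \<Rightarrow> 'v discrete_fun \<Rightarrow> 'v boundary_data \<Rightarrow> cell \<Rightarrow> 3 \<Rightarrow> real ^ 2 \<Rightarrow> 'v" where
  "ext_value \<T> u ub K i x =
     (if \<exists>K'. across \<T> K i K' then u (THE K'. across \<T> K i K') x else ub K i x)"

definition u_int :: "'v discrete_fun \<Rightarrow> cell \<Rightarrow> 3 \<Rightarrow> 3 \<Rightarrow> 'v" where
  "u_int u K i \<nu> = u K (gauss_point K i \<nu>)"

definition u_ext ::
  "cell set \<Rightarrow> 'v discrete_fun \<Rightarrow> 'v boundary_data \<Rightarrow> cell \<Rightarrow> 3 \<Rightarrow> 3 \<Rightarrow> 'v" where
  "u_ext \<T> u ub K i \<nu> = ext_value \<T> u ub K i (gauss_point K i \<nu>)"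

definition flux :: "('v \<Rightarrow> 'v) \<Rightarrow> ('v \<Rightarrow> 'v) \<Rightarrow> 'v::real_vector \<Rightarrow> real ^ 2 \<Rightarrow> 'v" where
  "flux f1 f2 v n = n $ 1 *\<^sub>R f1 v + n $ 2 *\<^sub>R f2 v"

definition next_avg ::
  "cell set \<Rightarrow> ('v \<Rightarrow> 'v) \<Rightarrow> ('v \<Rightarrow> 'v) \<Rightarrow> real \<Rightarrow> real \<Rightarrow> 'v::euclidean_space discrete_fun
     \<Rightarrow> 'v boundary_data \<Rightarrow> cell \<Rightarrow> 'v" where
  "next_avg \<T> f1 f2 \<alpha> \<Delta>t u ub K =
     cell_avg K (u K) - (\<Delta>t / (2 * area K)) *\<^sub>R
       (\<Sum>i\<in>UNIV. edge_len K i *\<^sub>R (\<Sum>\<nu>\<in>UNIV. gauss_weight $ \<nu> *\<^sub>R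
          (flux f1 f2 (u_int u K i \<nu>) (outward_normal K i)
           + flux f1 f2 (u_ext \<T> u ub K i \<nu>) (outward_normal K i)
           + \<alpha> *\<^sub>R u_int u K i \<nu> - \<alpha> *\<^sub>R u_ext \<T> u ub K i \<nu>)))"

definition u_star :: "'v::euclidean_space discrete_fun \<Rightarrow> cell \<Rightarrow> 'v" where
  "u_star u K =
     (cell_avg K (u K)
       - (\<Sum>i\<in>UNIV. edge_weight K i *\<^sub>R (\<Sum>\<nu>\<in>UNIV. gauss_weight $ \<nu> *\<^sub>R u_int u K i \<nu>)))
     /\<^sub>R (1 - (\<Sum>i\<in>UNIV. edge_weight K i))"

definition states_in ::
  "'v set \<Rightarrow> cell set \<Rightarrow> 'v::euclidean_space discrete_fun \<Rightarrow> 'v boundary_data \<Rightarrow> bool" where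
  "states_in G \<T> u ub \<longleftrightarrow>
     (\<forall>K\<in>\<T>. (\<forall>i \<nu>. u_int u K i \<nu> \<in> G \<and> u_ext \<T> u ub K i \<nu> \<in> G) \<and> u_star u K \<in> G)"

definition cfl :: "cell set \<Rightarrow> real \<Rightarrow> real \<Rightarrow> bool" where
  "cfl \<T> \<alpha> \<Delta>t \<longleftrightarrow> (\<forall>K\<in>\<T>. \<alpha> * (\<Delta>t / area K) \<le> cfl_const K)"

definition one_sided_values ::
  "cell set \<Rightarrow> 'v discrete_fun \<Rightarrow> 'v boundary_data \<Rightarrow> cell \<Rightarrow> 3 \<Rightarrow> 'v set" where
  "one_sided_values \<T> u ub K i = u K ` edge K i \<union> ext_value \<T> u ub K i ` edge K i"

section \<open>Systems: invariant region, GQL representation and weak LF property\<close>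

text \<open>The relation \<open>\<succ>\<close>: strict for indices in \<open>J\<close>, non-strict for the other ones.\<close>

definition succ_rel :: "'j set \<Rightarrow> 'j \<Rightarrow> real \<Rightarrow> real \<Rightarrow> bool" where
  "succ_rel J j a b \<longleftrightarrow> (if j \<in> J then a > b else a \<ge> b)"

definition region_of :: "'j set \<Rightarrow> 'j set \<Rightarrow> ('j \<Rightarrow> 'v \<Rightarrow> real) \<Rightarrow> 'v set" where
  "region_of J J' g = {u. \<forall>j\<in>J \<union> J'. succ_rel J j (g j u) 0}"

definition gql_boundary ::
  "'j set \<Rightarrow> 'j set \<Rightarrow> ('j \<Rightarrow> 'v \<Rightarrow> real) \<Rightarrow> 'j \<Rightarrow> 'v::euclidean_space set" where
  "gql_boundary J J' g j = frontier (region_of J J' g) \<inter> frontier {u. succ_rel J j (g j u) 0}"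

definition gradient :: "('v::euclidean_space \<Rightarrow> real) \<Rightarrow> 'v \<Rightarrow> 'v" where
  "gradient f u = (THE D. GDERIV f u :> D)"

definition gql_region ::
  "'j set \<Rightarrow> 'j set \<Rightarrow> ('j \<Rightarrow> 'v \<Rightarrow> real) \<Rightarrow> 'v::euclidean_space set" where
  "gql_region J J' g =
     {u. \<forall>j\<in>J \<union> J'. \<forall>us\<in>gql_boundary J J' g j. succ_rel J j ((u - us) \<bullet> gradient (g j) us) 0}"

definition gql_representable ::
  "'j set \<Rightarrow> 'j set \<Rightarrow> ('j \<Rightarrow> 'v::euclidean_space \<Rightarrow> real) \<Rightarrow> bool" where
  "gql_representable J J' g \<longleftrightarrow>
     J \<inter> J' = {} \<and>
     (\<forall>j\<in>J \<union> J'. \<forall>us\<in>gql_boundary J J' g j. g j differentiable (at us)) \<and>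
     region_of J J' g = gql_region J J' g"

text \<open>The bound \<open>\<zeta>\<close> is chosen before \<open>n\<close> and \<open>u\<close>: it depends on the boundary state only.\<close>

definition weak_LF ::
  "'j set \<Rightarrow> 'j set \<Rightarrow> ('j \<Rightarrow> 'v \<Rightarrow> real) \<Rightarrow> ('v \<Rightarrow> 'v) \<Rightarrow> ('v \<Rightarrow> 'v)
     \<Rightarrow> ('v::euclidean_space \<Rightarrow> real ^ 2 \<Rightarrow> real) \<Rightarrow> bool" where
  "weak_LF J J' g f1 f2 a \<longleftrightarrow>
     (\<exists>\<zeta> :: 'v \<Rightarrow> real ^ 2. \<forall>n. norm n = 1 \<longrightarrow> (\<forall>u\<in>region_of J J' g.
        0 < a u n \<and>
        (\<forall>j\<in>J \<union> J'. \<forall>us\<in>gql_boundary J J' g j.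
           succ_rel J j
             (a u n * ((u - us) \<bullet> gradient (g j) us) - flux f1 f2 u n \<bullet> gradient (g j) us)
             (\<zeta> us \<bullet> n))))"

text \<open>Hyperbolicity: at every interior state of \<open>G\<close> the Jacobian of the flux in any direction has
  an eigenbasis with real eigenvalues.\<close>

definition hyperbolic_on ::
  "'v set \<Rightarrow> ('v \<Rightarrow> 'v) \<Rightarrow> ('v \<Rightarrow> 'v::euclidean_space) \<Rightarrow> bool" where
  "hyperbolic_on G f1 f2 \<longleftrightarrow>
     (\<forall>u\<in>interior G. f1 differentiable (at u) \<and> f2 differentiable (at u) \<and>
        (\<forall>n. norm n = 1 \<longrightarrow> (\<exists>B. independent B \<and> span B = UNIV \<and>
           (\<forall>b\<in>B. \<exists>c::real. frechet_derivative (\<lambda>v. flux f1 f2 v n) (at u) b = c *\<^sub>R b))))"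

text \<open>The maxima defining the viscosity thresholds are taken as suprema in the extended reals. They
  agree with the maxima whenever these are attained, and are infinite if there is no bound.\<close>

definition alpha_wLF ::
  "cell set \<Rightarrow> ('v \<Rightarrow> real ^ 2 \<Rightarrow> real) \<Rightarrow> 'v discrete_fun \<Rightarrow> 'v boundary_data \<Rightarrow> ereal" where
  "alpha_wLF \<T> a u ub =
     (SUP K\<in>\<T>. SUP i. SUP v\<in>one_sided_values \<T> u ub K i. ereal (a v (outward_normal K i)))"

section \<open>Scalar equations\<close>

text \<open>\<open>F'\<close> is evaluated at the one-sided values of \<open>u\<close> on the edges of \<open>K\<close> and at the states
  between them. The intermediate states cannot be left out. Take the flux
  \<open>f1 v = 3 * v\<^sup>2 - 2 * v ^ 3\<close>, \<open>f2 = 0\<close> and cell-wise constant data, equal to \<open>1\<close> on one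
  neighbour of a cell \<open>K\<close>, across an edge whose normal has a positive first component, and to \<open>0\<close>
  on all other cells. Then \<open>F'\<close> vanishes at all one-sided values, but for small \<open>\<alpha> > 0\<close> the new
  average on \<open>K\<close> is negative.\<close>

definition alpha_LF ::
  "cell set \<Rightarrow> (real \<Rightarrow> real) \<Rightarrow> (real \<Rightarrow> real) \<Rightarrow> real discrete_fun \<Rightarrow> real boundary_data \<Rightarrow> ereal"
  where
  "alpha_LF \<T> f1 f2 u ub =
     (SUP K\<in>\<T>. SUP i. SUP v\<in>convex hull (\<Union>k. one_sided_values \<T> u ub K k).
        ereal \<bar>outward_normal K i $ 1 * deriv f1 v + outward_normal K i $ 2 * deriv f2 v\<bar>)"

definition extrema_on :: "(real ^ 2) set \<Rightarrow> (real ^ 2 \<Rightarrow> real) \<Rightarrow> real \<Rightarrow> real \<Rightarrow> bool" where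
  "extrema_on \<Omega> u0 u_min u_max \<longleftrightarrow>
     u_min \<in> u0 ` \<Omega> \<and> u_max \<in> u0 ` \<Omega> \<and> (\<forall>x\<in>\<Omega>. u_min \<le> u0 x \<and> u0 x \<le> u_max)"

end

theory Submission
  imports Defs
begin

text \<open>
  \<^bold>\<open>Bound preservation.\<close> Since the edge weights satisfy \<open>w\<^sub>i = C l\<^sub>i\<close> with \<open>C\<close> the CFL constant,
  the cell average is a convex combination of the inner state \<open>u\<^sup>*\<close> and the interior Gauss traces in
  which the trace at a node of edge \<open>i\<close> carries the weight \<open>C l\<^sub>i \<omega>\<^sub>\<nu>\<close>. The numerical flux through
  that node carries the same factor \<open>l\<^sub>i \<omega>\<^sub>\<nu>\<close>, so that the two can be compared node by node. Take an
  affine functional \<open>v \<mapsto> (v - c) \<bullet> N\<close> that is nonnegative at the interior traces. The (weak) LF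
  property bounds minus the flux from below by \<open>z \<bullet> n\<^sub>i\<close> minus \<open>\<alpha>\<close> times that functional, where \<open>z\<close>
  is independent of the node. The exterior traces cancel against the
  viscosity, the CFL condition makes the remaining coefficient of the interior traces nonnegative,
  and the terms \<open>z \<bullet> n\<^sub>i\<close> disappear because \<open>\<Sum>\<^sub>i l\<^sub>i n\<^sub>i = 0\<close> for a closed polygon. What is left is
  the positive multiple \<open>1 - \<Sum>\<^sub>i w\<^sub>i\<close> of the value at \<open>u\<^sup>*\<close>, which also keeps strict inequalities
  strict. This is \<open>next_avg_functional_bound\<close>. For systems it is applied to the half spaces of the GQL
  representation, with \<open>z = \<zeta>(u\<^sup>*\<^sub>j)\<close>. In the scalar case it is applied to the smallest and the largest
  of the Gauss traces of the cell: for an extremal state \<open>c\<close> the mean value theorem gives the same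
  kind of estimate with \<open>z = -F(c)\<close> or \<open>z = F(c)\<close>.

  \<^bold>\<open>Optimality.\<close> Let \<open>\<mu>\<close> be the minimum of \<open>w\<^sub>i / l\<^sub>i\<close> in a feasible decomposition. Testing it
  with \<open>p = q\<^sup>2\<close>, \<open>q\<close> affine, and dropping the nonnegative interior nodes gives
  \<open>avg\<^sub>K q\<^sup>2 \<ge> \<mu> \<Sum>\<^sub>i \<integral>q\<^sup>2 ds\<close>. In terms of the values \<open>m\<^sub>i\<close> of \<open>q\<close> at the edge midpoints, the left-hand
  side is \<open>\<Sum> m\<^sub>i\<^sup>2 / 3\<close> and the sum on the right is a quadratic form in \<open>m\<close>, the integrals
  being taken over the edges. The best bound on \<open>\<mu>\<close> is
  therefore the reciprocal of the largest eigenvalue of a symmetric 3 by 3 matrix built from the edge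
  lengths. Its characteristic polynomial has the root \<open>6 l_bar\<close>, and the quadratic left after this
  root is split off has the larger root \<open>(9 l_bar + 3 l_hat) / 2 = 1 / C\<close>. A test function belonging to
  an eigenvector for \<open>1 / C\<close> proves \<open>\<mu> \<le> C\<close>.
\<close>

section \<open>Geometry of a cell\<close>

text \<open>Twice the signed area; the sign tells whether the vertices are numbered counterclockwise.\<close>

definition orientation :: "cell \<Rightarrow> real" where
  "orientation K = (K $ 2 - K $ 1) $ 1 * (K $ 3 - K $ 1) $ 2 - (K $ 2 - K $ 1) $ 2 * (K $ 3 - K $ 1) $ 1"

text \<open>The simplifier adds numerals before it reduces them, so that the index of a following vertex
  shows up as a numeral above three.\<close>

lemma numeral_mod_3 [simp]: "(4::3) = 1" "(5::3) = 2" "(6::3) = 3"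
  by simp_all

lemma region_eq: "region K = convex hull {K $ 1, K $ 2, K $ 3}"
  by (simp add: region_def UNIV_3)

lemma area_eq: "area K = \<bar>orientation K\<bar> / 2"
proof -
  have "region K \<in> sets lborel"
    by (simp add: region_eq borel_closed compact_imp_closed finite_imp_compact_convex_hull)
  then have "area K = measure lborel (convex hull {K $ 1, K $ 2, K $ 3})"
    by (simp add: area_def region_eq measure_completion)
  also have "\<dots> = \<bar>- orientation K\<bar> / 2"
    unfolding content_triangle
    by (rule arg_cong[where f = "\<lambda>x. \<bar>x\<bar> / 2"]) (simp add: orientation_def algebra_simps)
  finally show ?thesis by simp
qed

text \<open>By Lagrange's identity \<open>(x \<times> y)\<^sup>2 = |x|\<^sup>2 |y|\<^sup>2 - (x \<bullet> y)\<^sup>2\<close>, a vanishing orientation is the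
  equality case of the Cauchy--Schwarz inequality.\<close>

lemma orientation_nonzero:
  assumes "\<not> collinear (range (($) K))"
  shows "orientation K \<noteq> 0"
proof
  assume *: "orientation K = 0"
  define x y where "x = K $ 2 - K $ 1" and "y = K $ 3 - K $ 1"
  have "(orientation K)\<^sup>2 = (x \<bullet> x) * (y \<bullet> y) - (x \<bullet> y)\<^sup>2"
    by (simp add: orientation_def x_def y_def inner_vec_def sum_2 power2_eq_square algebra_simps)
  then have "(x \<bullet> y)\<^sup>2 = (norm x * norm y)\<^sup>2"
    using * by (simp add: power_mult_distrib power2_norm_eq_inner)
  then have "\<bar>x \<bullet> y\<bar> = norm x * norm y"
    using power2_eq_imp_eq[of "\<bar>x \<bullet> y\<bar>" "norm x * norm y"] by simp
  then have "collinear {0, x, y}" by (simp add: norm_cauchy_schwarz_equal)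
  then have "collinear {K $ 2, K $ 1, K $ 3}"
    using collinear_3[of "K $ 2" "K $ 1" "K $ 3"] by (simp add: x_def y_def)
  with assms show False by (simp add: UNIV_3 insert_commute)
qed

lemma orientation_cyclic:
  "(K $ (i + 1) - K $ i) $ 1 * (K $ (i + 2) - K $ i) $ 2
     - (K $ (i + 1) - K $ i) $ 2 * (K $ (i + 2) - K $ i) $ 1 = orientation K"
  using exhaust_3[of i] by (auto simp: orientation_def algebra_simps)

lemma edge_len_pos:
  assumes "orientation K \<noteq> 0"
  shows "0 < edge_len K i"
  using assms orientation_cyclic[of K i] by (auto simp: edge_len_def)

text \<open>Multiplied with its edge length, the outward normal is the edge vector turned by a right angle,
  clockwise for a counterclockwise cell. In particular it is linear in the vertices up to the
  sign, which is shared by all three edges.\<close>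

lemma scaled_outward_normal:
  assumes "orientation K \<noteq> 0"
  shows "norm (outward_normal K i) = 1"
    and "edge_len K i *\<^sub>R outward_normal K i
      = sgn (orientation K) *\<^sub>R vector [(K $ (i + 1) - K $ i) $ 2, - (K $ (i + 1) - K $ i) $ 1]"
proof -
  define D where "D = orientation K"
  define l where "l = edge_len K i"
  define e where "e = K $ (i + 1) - K $ i"
  define w where "w = K $ (i + 2) - K $ i"
  define r where "r = (vector [e $ 2, - e $ 1] :: real ^ 2)"
  define m where "m = (sgn D / l) *\<^sub>R r"
  have l: "0 < l" using edge_len_pos[OF assms] by (simp add: l_def)
  have D: "e $ 1 * w $ 2 - e $ 2 * w $ 1 = D" "D \<noteq> 0"
    using orientation_cyclic[of K i] assms by (simp_all add: e_def w_def D_def)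
  have le: "l = norm e" by (simp add: l_def e_def edge_len_def dist_norm norm_minus_commute)
  have l2: "e $ 1 * e $ 1 + e $ 2 * e $ 2 = l\<^sup>2"
    by (simp add: le power2_norm_eq_inner inner_vec_def sum_2)
  have "norm r = l"
    by (simp add: le r_def norm_eq_sqrt_inner inner_vec_def sum_2 add.commute)
  then have m1: "norm m = 1" using l D by (simp add: m_def sgn_real_def)
  have m2: "m \<bullet> e = 0"
    by (simp add: m_def r_def inner_vec_def sum_2)
  have rw: "r \<bullet> w = - D"
    by (simp add: r_def inner_vec_def sum_2 D(1)[symmetric])
  then have "m \<bullet> w = - (sgn D * D) / l"
    by (simp add: m_def)
  also have "\<dots> < 0" using l D(2) by (simp add: sgn_real_def)
  finally have m3: "m \<bullet> w < 0" .
  have uniq: "n = m" if n: "norm n = 1" "n \<bullet> e = 0" "n \<bullet> w < 0" for n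
  proof -
    define c where "c = (n \<bullet> r) / l\<^sup>2"
    have ne: "n $ 1 * e $ 1 + n $ 2 * e $ 2 = 0" using n(2) by (simp add: inner_vec_def sum_2)
    have "l\<^sup>2 * n $ 1 = (n \<bullet> r) * e $ 2"
      unfolding l2[symmetric] using ne by (simp add: inner_vec_def sum_2 r_def) algebra
    moreover have "l\<^sup>2 * n $ 2 = - (n \<bullet> r) * e $ 1"
      unfolding l2[symmetric] using ne by (simp add: inner_vec_def sum_2 r_def) algebra
    ultimately have nc: "n = c *\<^sub>R r"
      using l by (simp add: vec_eq_iff forall_2 c_def r_def field_simps)
    then have "\<bar>c\<bar> * l = 1" using n(1) \<open>norm r = l\<close> by simp
    moreover have "n \<bullet> w = - c * D"
      by (simp add: nc rw)
    then have "0 < c * D" using n(3) by simp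
    ultimately have "c = sgn D / l"
      using l by (auto simp: sgn_real_def zero_less_mult_iff field_simps split: if_splits)
    then show ?thesis by (simp add: nc m_def)
  qed
  have *: "outward_normal K i = m"
    unfolding outward_normal_def e_def[symmetric] w_def[symmetric]
    by (rule the_equality) (use m1 m2 m3 uniq in blast)+
  show "norm (outward_normal K i) = 1" using m1 by (simp add: *)
  show "edge_len K i *\<^sub>R outward_normal K i
      = sgn (orientation K) *\<^sub>R vector [(K $ (i + 1) - K $ i) $ 2, - (K $ (i + 1) - K $ i) $ 1]"
    using l by (simp add: * m_def flip: l_def D_def e_def r_def)
qed

text \<open>The edge vectors of a triangle add up to zero, hence so do the turned edge vectors.\<close>

lemma sum_scaled_outward_normals:
  assumes "orientation K \<noteq> 0"
  shows "(\<Sum>i\<in>UNIV. edge_len K i *\<^sub>R outward_normal K i) = 0"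
  by (simp add: scaled_outward_normal(2)[OF assms] sum_3 vec_eq_iff forall_2 algebra_simps)

lemma l_bar_pos: assumes "orientation K \<noteq> 0" shows "0 < l_bar K"
  using edge_len_pos[OF assms] by (simp add: l_bar_def sum_3 add_pos_pos)

text \<open>The radicand is a third of the sum of the squared lengths and of the squared differences of
  the lengths, so the square root is a genuine one.\<close>

lemma l_hat_square: 
  "(l_hat K)\<^sup>2 = (\<Sum>i\<in>UNIV. (edge_len K i)\<^sup>2)
                   - 2 / 3 * (\<Sum>i\<in>UNIV. edge_len K i * edge_len K (i + 1))"
  and l_hat_nonneg: "0 \<le> l_hat K"
proof -
  have "0 \<le> x\<^sup>2 + y\<^sup>2 + z\<^sup>2 - 2 / 3 * (x * y + y * z + z * x)" for x y z :: real
  proof -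
    have "0 \<le> 1 / 3 * ((x - y)\<^sup>2 + (y - z)\<^sup>2 + (z - x)\<^sup>2) + 1 / 3 * (x\<^sup>2 + y\<^sup>2 + z\<^sup>2)" by simp
    also have "\<dots> = x\<^sup>2 + y\<^sup>2 + z\<^sup>2 - 2 / 3 * (x * y + y * z + z * x)"
      by (simp add: power2_eq_square algebra_simps)
    finally show ?thesis .
  qed
  then have "0 \<le> (\<Sum>i\<in>UNIV. (edge_len K i)\<^sup>2) - 2 / 3 * (\<Sum>i\<in>UNIV. edge_len K i * edge_len K (i + 1))"
    by (simp only: sum_3) simp
  then show "(l_hat K)\<^sup>2 = (\<Sum>i\<in>UNIV. (edge_len K i)\<^sup>2)
                   - 2 / 3 * (\<Sum>i\<in>UNIV. edge_len K i * edge_len K (i + 1))" "0 \<le> l_hat K"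
    by (simp_all add: l_hat_def)
qed

lemma edge_weight_eq: "edge_weight K i = cfl_const K * edge_len K i"
  by (simp add: edge_weight_def cfl_const_def)

text \<open>The sum is at most two thirds, because \<open>l_hat\<close> is nonnegative.\<close>

lemma sum_edge_weight_less_1:
  assumes "orientation K \<noteq> 0"
  shows "(\<Sum>i\<in>UNIV. edge_weight K i) < 1"
proof -
  have "(\<Sum>i\<in>UNIV. edge_weight K i) = 6 * l_bar K / (9 * l_bar K + 3 * l_hat K)"
    by (simp add: edge_weight_eq cfl_const_def l_bar_def sum_3 add_divide_distrib)
  also have "\<dots> < 1" using l_bar_pos[OF assms] l_hat_nonneg[of K] by simp
  finally show ?thesis .
qed

lemma mesh_cell_orientation:
  assumes "mesh_of \<T> \<Omega>" "K \<in> \<T>"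
  shows "orientation K \<noteq> 0"
  using assms orientation_nonzero by (auto simp: mesh_of_def)

section \<open>Bound preservation\<close>

lemma sum_gauss_weight: "(\<Sum>\<nu>\<in>UNIV. gauss_weight $ \<nu>) = 1"
  by (simp add: gauss_weight_def sum_3)

lemma gauss_weight_nonneg: "0 \<le> gauss_weight $ \<nu>"
  using exhaust_3[of \<nu>] by (auto simp: gauss_weight_def)

lemma gauss_point_in_edge: "gauss_point K i \<nu> \<in> edge K i"
proof -
  define s :: real where "s = sqrt 15"
  have "0 \<le> s" "s \<le> 5" by (auto simp: s_def intro: real_le_lsqrt)
  then have "0 \<le> gauss_node $ \<nu>" "gauss_node $ \<nu> \<le> 1"
    using exhaust_3[of \<nu>] by (auto simp: gauss_node_def simp flip: s_def)
  then show ?thesis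
    by (auto simp: gauss_point_def edge_point_def edge_def closed_segment_def)
qed

lemma gauss_traces_one_sided:
  "u_int u K i \<nu> \<in> one_sided_values \<T> u ub K i" "u_ext \<T> u ub K i \<nu> \<in> one_sided_values \<T> u ub K i"
  using gauss_point_in_edge by (auto simp: u_int_def u_ext_def one_sided_values_def)

lemma cfl_const_pos:
  assumes "orientation K \<noteq> 0"
  shows "0 < cfl_const K"
  using l_bar_pos[OF assms] l_hat_nonneg[of K] by (simp add: cfl_const_def add_pos_nonneg)

lemma cell_avg_decomposition:
  assumes "orientation K \<noteq> 0"
  shows "cell_avg K (u K) = (1 - (\<Sum>i\<in>UNIV. edge_weight K i)) *\<^sub>R u_star u K
    + (\<Sum>i\<in>UNIV. edge_weight K i *\<^sub>R (\<Sum>\<nu>\<in>UNIV. gauss_weight $ \<nu> *\<^sub>R u_int u K i \<nu>))"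
  using sum_edge_weight_less_1[OF assms] by (simp add: u_star_def)

text \<open>The common core of the system and the scalar case. The hypotheses on the fluxes are the weak LF
  property for the half space \<open>0 \<le> (v - c) \<bullet> N\<close>; as the vector \<open>z\<close> is the same
  for all edges, the terms \<open>z \<bullet> n\<^sub>i\<close> cancel in the sum over the edges.\<close>

lemma next_avg_functional_bound:
  fixes u :: "'v::euclidean_space discrete_fun" and N c :: 'v and z :: "real ^ 2"
  assumes K: "orientation K \<noteq> 0" and dt: "0 \<le> \<Delta>t"
    and cfl: "\<alpha> * (\<Delta>t / area K) \<le> cfl_const K"
    and nonneg: "\<And>i \<nu>. 0 \<le> (u_int u K i \<nu> - c) \<bullet> N"
    and int: "\<And>i \<nu>. z \<bullet> outward_normal K i \<le>
      \<alpha> * ((u_int u K i \<nu> - c) \<bullet> N) - flux f1 f2 (u_int u K i \<nu>) (outward_normal K i) \<bullet> N"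
    and ext: "\<And>i \<nu>. z \<bullet> outward_normal K i \<le>
      \<alpha> * ((u_ext \<T> u ub K i \<nu> - c) \<bullet> N) - flux f1 f2 (u_ext \<T> u ub K i \<nu>) (outward_normal K i) \<bullet> N"
  shows "(1 - (\<Sum>i\<in>UNIV. edge_weight K i)) * ((u_star u K - c) \<bullet> N)
    \<le> (next_avg \<T> f1 f2 \<alpha> \<Delta>t u ub K - c) \<bullet> N"
proof -
  define W where "W = (\<Sum>i\<in>UNIV. edge_weight K i)"
  define \<tau> where "\<tau> = \<Delta>t / area K"
  define C where "C = cfl_const K"
  define U where "U i \<nu> = (u_int u K i \<nu> - c) \<bullet> N" for i \<nu>
  define V where "V i \<nu> = (u_ext \<T> u ub K i \<nu> - c) \<bullet> N" for i \<nu>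
  define X where "X i \<nu> = flux f1 f2 (u_int u K i \<nu>) (outward_normal K i) \<bullet> N" for i \<nu>
  define Y where "Y i \<nu> = flux f1 f2 (u_ext \<T> u ub K i \<nu>) (outward_normal K i) \<bullet> N" for i \<nu>
  \<comment> \<open>The net contribution of a node: its share of the cell average minus the flux through it.\<close>
  define R where "R i \<nu> = C * U i \<nu> - \<tau> / 2 * (X i \<nu> + Y i \<nu> + \<alpha> * U i \<nu> - \<alpha> * V i \<nu>)" for i \<nu>
  have \<tau>: "0 \<le> \<tau>" using dt by (simp add: \<tau>_def area_eq)
  have "cell_avg K (u K) \<bullet> N - c \<bullet> N = (1 - W) * ((u_star u K - c) \<bullet> N)
      + (\<Sum>i\<in>UNIV. edge_weight K i * ((\<Sum>\<nu>\<in>UNIV. gauss_weight $ \<nu> * (u_int u K i \<nu> \<bullet> N)) - c \<bullet> N))"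
    unfolding cell_avg_decomposition[OF K] W_def[symmetric]
    by (simp add: inner_add_left inner_sum_left inner_diff_left algebra_simps sum_subtractf
        W_def sum_distrib_left)
  also have "\<dots> = (1 - W) * ((u_star u K - c) \<bullet> N)
      + (\<Sum>i\<in>UNIV. edge_len K i * (\<Sum>\<nu>\<in>UNIV. gauss_weight $ \<nu> * (C * U i \<nu>)))"
  proof -
    have "(\<Sum>\<nu>\<in>UNIV. gauss_weight $ \<nu> * (u_int u K i \<nu> \<bullet> N)) - c \<bullet> N
        = (\<Sum>\<nu>\<in>UNIV. gauss_weight $ \<nu> * U i \<nu>)" for i
    proof -
      have "(\<Sum>\<nu>\<in>UNIV. gauss_weight $ \<nu> * U i \<nu>) = (\<Sum>\<nu>\<in>UNIV. gauss_weight $ \<nu> * (u_int u K i \<nu> \<bullet> N)) - (\<Sum>\<nu>\<in>UNIV. gauss_weight $ \<nu>) * (c \<bullet> N)"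
        by (simp add: U_def inner_diff_left algebra_simps sum_subtractf sum_distrib_left)
      then show ?thesis by (simp add: sum_gauss_weight)
    qed
    moreover have "(\<Sum>\<nu>\<in>UNIV. gauss_weight $ \<nu> * (C * U i \<nu>)) = C * (\<Sum>\<nu>\<in>UNIV. gauss_weight $ \<nu> * U i \<nu>)" for i
      by (simp add: sum_distrib_left algebra_simps)
    ultimately show ?thesis
      by (simp add: edge_weight_eq C_def mult.assoc mult.left_commute)
  qed
  finally have avg: "(cell_avg K (u K) - c) \<bullet> N = \<dots>" by (simp add: inner_diff_left)
  have "\<alpha> * (u_int u K i \<nu> \<bullet> N) - \<alpha> * (u_ext \<T> u ub K i \<nu> \<bullet> N) = \<alpha> * U i \<nu> - \<alpha> * V i \<nu>" for i \<nu>
    by (simp add: U_def V_def inner_diff_left algebra_simps)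
  then have "(next_avg \<T> f1 f2 \<alpha> \<Delta>t u ub K - c) \<bullet> N = (cell_avg K (u K) - c) \<bullet> N
      - \<tau> / 2 * (\<Sum>i\<in>UNIV. edge_len K i * (\<Sum>\<nu>\<in>UNIV. gauss_weight $ \<nu> *
           (X i \<nu> + Y i \<nu> + \<alpha> * U i \<nu> - \<alpha> * V i \<nu>)))"
    by (simp add: next_avg_def \<tau>_def X_def Y_def inner_diff_left inner_add_left inner_sum_left add_diff_eq[symmetric])
  also have "\<dots> = (1 - W) * ((u_star u K - c) \<bullet> N)
      + (\<Sum>i\<in>UNIV. edge_len K i * (\<Sum>\<nu>\<in>UNIV. gauss_weight $ \<nu> * R i \<nu>))"
    unfolding avg R_def
    by (simp add: right_diff_distrib sum_subtractf sum_distrib_left mult.left_commute)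
  finally have next_eq: "(next_avg \<T> f1 f2 \<alpha> \<Delta>t u ub K - c) \<bullet> N = \<dots>" .
  have R: "\<tau> * (z \<bullet> outward_normal K i) \<le> R i \<nu>" for i \<nu>
  proof -
    have "\<tau> / 2 * (X i \<nu> + Y i \<nu> + \<alpha> * U i \<nu> - \<alpha> * V i \<nu>)
        \<le> \<tau> / 2 * (2 * (\<alpha> * U i \<nu>) - 2 * (z \<bullet> outward_normal K i))"
      using int[of i \<nu>] ext[of i \<nu>] \<tau>
      by (intro mult_left_mono) (simp_all add: U_def V_def X_def Y_def)
    also have "\<dots> = (\<alpha> * \<tau>) * U i \<nu> - \<tau> * (z \<bullet> outward_normal K i)"
      by (simp add: algebra_simps)
    also have "\<dots> \<le> C * U i \<nu> - \<tau> * (z \<bullet> outward_normal K i)"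
      using mult_right_mono[OF cfl nonneg[of i \<nu>]] by (simp add: \<tau>_def C_def U_def)
    finally show ?thesis by (simp add: R_def)
  qed
  \<comment> \<open>The lower bounds of the nodes add up to zero, as \<open>z\<close> is a constant vector.\<close>
  have "0 = \<tau> * (z \<bullet> (\<Sum>i\<in>UNIV. edge_len K i *\<^sub>R outward_normal K i))"
    by (simp add: sum_scaled_outward_normals[OF K])
  also have "\<dots> = (\<Sum>i\<in>UNIV. edge_len K i * ((\<Sum>\<nu>\<in>UNIV. gauss_weight $ \<nu>) * (\<tau> * (z \<bullet> outward_normal K i))))"
    by (simp add: sum_gauss_weight inner_sum_right sum_distrib_left algebra_simps)
  also have "\<dots> \<le> (\<Sum>i\<in>UNIV. edge_len K i * (\<Sum>\<nu>\<in>UNIV. gauss_weight $ \<nu> * R i \<nu>))"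
    unfolding sum_distrib_right
    by (intro sum_mono mult_left_mono R gauss_weight_nonneg) (simp add: edge_len_def)
  finally show ?thesis by (simp add: next_eq W_def)
qed

lemma alpha_wLF_upper:
  assumes "K \<in> \<T>" "v \<in> one_sided_values \<T> u ub K i" "alpha_wLF \<T> a u ub \<le> ereal \<alpha>"
  shows "a v (outward_normal K i) \<le> \<alpha>"
proof -
  have "ereal (a v (outward_normal K i)) \<le> alpha_wLF \<T> a u ub"
    unfolding alpha_wLF_def
    by (intro SUP_upper2[OF assms(1)] SUP_upper2[where i = i] SUP_upper2[OF assms(2)]) simp_all
  also note assms(3)
  finally show ?thesis by simp
qed

lemma succ_rel_imp_le: "succ_rel J j a b \<Longrightarrow> b \<le> a"
  by (auto simp: succ_rel_def split: if_splits)

text \<open>Each half space of the GQL representation is preserved. A strict half space stays strict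
  because the inner state lies in it and has a positive weight.\<close>

lemma system_bound_preserving:
  assumes mesh: "mesh_of \<T> \<Omega>" and K: "K \<in> \<T>"
    and gql: "gql_representable J J' g" and wLF: "weak_LF J J' g f1 f2 a"
    and states: "states_in (region_of J J' g) \<T> u ub"
    and \<alpha>: "alpha_wLF \<T> a u ub \<le> ereal \<alpha>" and dt: "0 \<le> \<Delta>t" and cfl: "cfl \<T> \<alpha> \<Delta>t"
  shows "next_avg \<T> f1 f2 \<alpha> \<Delta>t u ub K \<in> region_of J J' g"
proof -
  define G where "G = region_of J J' g"
  have G: "G = gql_region J J' g" using gql by (simp add: gql_representable_def G_def)
  note ori = mesh_cell_orientation[OF mesh K]
  obtain \<zeta> :: "_ \<Rightarrow> real ^ 2" where \<zeta>: "\<And>n v j us. norm n = 1 \<Longrightarrow> v \<in> G \<Longrightarrow> j \<in> J \<union> J' \<Longrightarrow>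
      us \<in> gql_boundary J J' g j \<Longrightarrow>
      succ_rel J j (a v n * ((v - us) \<bullet> gradient (g j) us) - flux f1 f2 v n \<bullet> gradient (g j) us) (\<zeta> us \<bullet> n)"
    using wLF unfolding weak_LF_def G_def by blast
  have "succ_rel J j ((next_avg \<T> f1 f2 \<alpha> \<Delta>t u ub K - us) \<bullet> gradient (g j) us) 0"
    if j: "j \<in> J \<union> J'" and us: "us \<in> gql_boundary J J' g j" for j us
  proof -
    define N where "N = gradient (g j) us"
    have pos: "succ_rel J j ((v - us) \<bullet> N) 0" if "v \<in> G" for v
      using that j us unfolding G gql_region_def N_def by blast
    have bound: "\<zeta> us \<bullet> outward_normal K i \<le> \<alpha> * ((v - us) \<bullet> N) - flux f1 f2 v (outward_normal K i) \<bullet> N"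
      if v: "v \<in> G" "v \<in> one_sided_values \<T> u ub K i" for v i
    proof -
      have "\<zeta> us \<bullet> outward_normal K i
          \<le> a v (outward_normal K i) * ((v - us) \<bullet> N) - flux f1 f2 v (outward_normal K i) \<bullet> N"
        unfolding N_def
        using \<zeta>[OF scaled_outward_normal(1)[OF ori] v(1) j us] by (rule succ_rel_imp_le)
      also have "\<dots> \<le> \<alpha> * ((v - us) \<bullet> N) - flux f1 f2 v (outward_normal K i) \<bullet> N"
        using alpha_wLF_upper[OF K v(2) \<alpha>] succ_rel_imp_le[OF pos[OF v(1)]]
        by (simp add: mult_right_mono)
      finally show ?thesis .
    qed
    have traces: "u_int u K i \<nu> \<in> G" "u_ext \<T> u ub K i \<nu> \<in> G" "u_star u K \<in> G" for i \<nu>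
      using states K by (auto simp: states_in_def G_def)
    have "(1 - (\<Sum>i\<in>UNIV. edge_weight K i)) * ((u_star u K - us) \<bullet> N)
        \<le> (next_avg \<T> f1 f2 \<alpha> \<Delta>t u ub K - us) \<bullet> N"
      using cfl K
      by (intro next_avg_functional_bound[OF ori dt, where z = "\<zeta> us"] bound traces
          gauss_traces_one_sided succ_rel_imp_le[OF pos]) (auto simp: cfl_def)
    moreover have "succ_rel J j ((u_star u K - us) \<bullet> N) 0"
      by (rule pos) (rule traces)
    ultimately show ?thesis
      using sum_edge_weight_less_1[OF ori] unfolding succ_rel_def N_def
      by (auto split: if_splits intro: order.strict_trans2[rotated] order_trans[rotated])
  qed
  then show ?thesis
    unfolding G_def[symmetric] unfolding G gql_region_def by blast
qed

text \<open>Mean value theorem on the convex hull over which the viscosity threshold is taken.\<close>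

lemma alpha_LF_flux_lipschitz:
  fixes f1 f2 :: "real \<Rightarrow> real"
  assumes "K \<in> \<T>" and diff: "\<And>v. f1 field_differentiable (at v)" "\<And>v. f2 field_differentiable (at v)"
    and "alpha_LF \<T> f1 f2 u ub \<le> ereal \<alpha>"
    and "v \<in> convex hull (\<Union>k. one_sided_values \<T> u ub K k)"
    and "c \<in> convex hull (\<Union>k. one_sided_values \<T> u ub K k)"
  shows "\<bar>flux f1 f2 v (outward_normal K i) - flux f1 f2 c (outward_normal K i)\<bar> \<le> \<alpha> * \<bar>v - c\<bar>"
proof -
  define H where "H = convex hull (\<Union>k. one_sided_values \<T> u ub K k)"
  define n where "n = outward_normal K i"
  define F' where "F' x = n $ 1 * deriv f1 x + n $ 2 * deriv f2 x" for x
  have "((\<lambda>x. flux f1 f2 x n) has_field_derivative F' x) (at x within H)" for x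
    unfolding flux_def F'_def real_scaleR_def
    by (intro DERIV_add DERIV_cmult has_field_derivative_at_within[OF DERIV_deriv_iff_field_differentiable[THEN iffD2]] diff)
  moreover have "norm (F' x) \<le> \<alpha>" if "x \<in> H" for x
  proof -
    have "ereal \<bar>F' x\<bar> \<le> alpha_LF \<T> f1 f2 u ub"
      unfolding alpha_LF_def H_def[symmetric]
      by (intro SUP_upper2[OF assms(1)] SUP_upper2[where i = i] SUP_upper2[OF that[unfolded H_def]])
        (auto simp: F'_def n_def)
    also note assms(4)
    finally show ?thesis by simp
  qed
  ultimately show ?thesis
    using field_differentiable_bound[of H "\<lambda>x. flux f1 f2 x n" F' \<alpha> v c] assms(5,6)
    by (simp add: H_def n_def)
qed

text \<open>The threshold controls the flux only between values that \<open>u\<close> takes on the edges of the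
  cell, and the global bounds \<open>m\<close> and \<open>M\<close> need not be among them. The comparison states are therefore
  the extreme Gauss traces of the cell; the new average is then bounded by a convex combination
  of such a trace and the inner state, and both of these lie between \<open>m\<close> and \<open>M\<close>.\<close>

lemma scalar_bound_preserving:
  fixes f1 f2 :: "real \<Rightarrow> real"
  assumes mesh: "mesh_of \<T> \<Omega>" and K: "K \<in> \<T>"
    and diff: "\<And>v. f1 field_differentiable (at v)" "\<And>v. f2 field_differentiable (at v)"
    and states: "states_in {m..M} \<T> u ub"
    and \<alpha>: "alpha_LF \<T> f1 f2 u ub \<le> ereal \<alpha>" and dt: "0 \<le> \<Delta>t" and cfl: "cfl \<T> \<alpha> \<Delta>t"
  shows "next_avg \<T> f1 f2 \<alpha> \<Delta>t u ub K \<in> {m..M}"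
proof -
  note ori = mesh_cell_orientation[OF mesh K]
  define W where "W = (\<Sum>i\<in>UNIV. edge_weight K i)"
  define T where "T = range (\<lambda>(i, \<nu>). u_int u K i \<nu>) \<union> range (\<lambda>(i, \<nu>). u_ext \<T> u ub K i \<nu>)"
  have T: "finite T" "T \<noteq> {}" by (auto simp: T_def)
  have TI: "u_int u K i \<nu> \<in> T" "u_ext \<T> u ub K i \<nu> \<in> T" for i \<nu>
    by (force simp: T_def)+
  have T_bounds: "T \<subseteq> {m..M}" and star: "u_star u K \<in> {m..M}"
    using states K by (auto simp: states_in_def T_def)
  define H where "H = (\<Union>k. one_sided_values \<T> u ub K k)"
  have "u_int u K i \<nu> \<in> H" "u_ext \<T> u ub K i \<nu> \<in> H" for i \<nu>
    using gauss_traces_one_sided(1)[of u K i \<nu> \<T> ub] gauss_traces_one_sided(2)[of \<T> u ub K i \<nu>]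
    unfolding H_def by blast+
  then have "T \<subseteq> H" unfolding T_def by (auto simp only: image_iff)
  then have T_hull: "T \<subseteq> convex hull H"
    by (rule order_trans) (rule hull_subset)
  have lip: "\<bar>flux f1 f2 v (outward_normal K i) - flux f1 f2 c (outward_normal K i)\<bar> \<le> \<alpha> * \<bar>v - c\<bar>"
    if "v \<in> T" "c \<in> T" for v c i
    using that T_hull by (intro alpha_LF_flux_lipschitz[OF K diff \<alpha>]) (auto simp flip: H_def)
  have cflK: "\<alpha> * (\<Delta>t / area K) \<le> cfl_const K" using cfl K by (simp add: cfl_def)
  have W: "0 \<le> W" "W < 1"
    unfolding W_def using sum_edge_weight_less_1[OF ori]
    by (auto simp: edge_weight_eq cfl_const_pos[OF ori] edge_len_pos[OF ori] less_imp_le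
        intro!: sum_nonneg mult_nonneg_nonneg)
  \<comment> \<open>The sign \<open>s\<close> is \<open>1\<close> for the lower and \<open>- 1\<close> for the upper bound.\<close>
  have bound: "(1 - W) * ((u_star u K - c) * s) \<le> (next_avg \<T> f1 f2 \<alpha> \<Delta>t u ub K - c) * s"
    if c: "c \<in> T" and s: "s \<in> {1, - 1}" and ext: "\<And>v. v \<in> T \<Longrightarrow> 0 \<le> (v - c) * s" for c s
  proof -
    have zc: "vector [f1 c, f2 c] \<bullet> outward_normal K i = flux f1 f2 c (outward_normal K i)" for i
      by (simp add: inner_vec_def sum_2 flux_def algebra_simps)
    have "- s * flux f1 f2 c (outward_normal K i) \<le> \<alpha> * ((v - c) * s) - flux f1 f2 v (outward_normal K i) * s"
      if "v \<in> T" for v i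
      using lip[OF that c, of i] ext[OF that] s by (auto simp: abs_if algebra_simps split: if_splits)
    then show ?thesis
      using next_avg_functional_bound[OF ori dt cflK, where u = u and c = c and N = s and z = "- s *\<^sub>R vector [f1 c, f2 c]"
          and ?f1.0 = f1 and ?f2.0 = f2 and \<T> = \<T> and ub = ub]
        ext TI by (simp add: zc W_def)
  qed
  have "Min T \<in> T" "Max T \<in> T" using T by simp_all
  have "m \<le> (1 - W) * u_star u K + W * Min T"
  proof -
    have "(1 - W) * m + W * m \<le> (1 - W) * u_star u K + W * Min T"
      using W star T_bounds \<open>Min T \<in> T\<close> by (intro add_mono mult_left_mono) auto
    then show ?thesis by (simp add: algebra_simps)
  qed
  also have "\<dots> \<le> next_avg \<T> f1 f2 \<alpha> \<Delta>t u ub K"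
    using bound[OF \<open>Min T \<in> T\<close>, of 1] T by (simp add: algebra_simps)
  finally have "m \<le> next_avg \<T> f1 f2 \<alpha> \<Delta>t u ub K" .
  moreover have "next_avg \<T> f1 f2 \<alpha> \<Delta>t u ub K \<le> (1 - W) * u_star u K + W * Max T"
  proof -
    have "(1 - W) * ((u_star u K - Max T) * (- 1)) \<le> (next_avg \<T> f1 f2 \<alpha> \<Delta>t u ub K - Max T) * (- 1)"
      using T by (intro bound \<open>Max T \<in> T\<close>) simp_all
    then show ?thesis by (simp add: algebra_simps)
  qed
  moreover have "(1 - W) * u_star u K + W * Max T \<le> (1 - W) * M + W * M"
    using W star T_bounds \<open>Max T \<in> T\<close> by (intro add_mono mult_left_mono) auto
  moreover have "(1 - W) * M + W * M = M" by (simp add: algebra_simps)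
  ultimately show ?thesis by simp
qed

section \<open>Integrals of squared affine functions over triangles and edges\<close>

lemma prod_Basis_vec2: "(\<Prod>b\<in>Basis. (x :: real ^ 2) \<bullet> b) = x $ 1 * x $ 2"
  by (simp add: Basis_vec_def UNION_singleton_eq_range axis_eq_axis prod.reindex inj_on_def
      inner_axis UNIV_2)

lemma borel_measurable_vector2: "(\<lambda>(s, t). vector [s, t] :: real ^ 2) \<in> borel_measurable borel"
proof (rule borel_measurable_continuous_onI)
  have "continuous_on UNIV (\<lambda>(s, t). (\<chi> i. if i = 1 then s else t) :: real ^ 2)"
    unfolding case_prod_unfold by (rule continuous_on_vec_lambda) (case_tac "i = 1"; simp add: continuous_intros)
  moreover have "(\<lambda>(s, t). vector [s, t] :: real ^ 2) = (\<lambda>(s, t). (\<chi> i. if i = 1 then s else t))"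
    by (auto simp: fun_eq_iff vec_eq_iff forall_2)
  ultimately show "continuous_on UNIV (\<lambda>(s, t). vector [s, t] :: real ^ 2)" by simp
qed

text \<open>This makes Fubini's theorem available on \<open>real ^ 2\<close>, which is not a product type.\<close>

lemma lborel_vec2:
  "(lborel :: (real ^ 2) measure) = distr (lborel \<Otimes>\<^sub>M lborel) borel (\<lambda>(s, t). vector [s, t])"
proof (rule lborel_eqI)
  have meas: "(\<lambda>(s, t). vector [s, t] :: real ^ 2) \<in> (lborel \<Otimes>\<^sub>M lborel) \<rightarrow>\<^sub>M borel"
    using borel_measurable_vector2 by (simp add: lborel_prod)
  fix l u :: "real ^ 2" assume le: "\<And>b. b \<in> Basis \<Longrightarrow> l \<bullet> b \<le> u \<bullet> b"
  then have le': "l $ 1 \<le> u $ 1" "l $ 2 \<le> u $ 2"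
    by (auto simp: cart_eq_inner_axis axis_in_Basis_iff)
  have pre: "(\<lambda>(s, t). vector [s, t]) -` box l u = {l $ 1<..<u $ 1} \<times> {l $ 2<..<u $ 2}"
    by (auto simp: mem_box_cart forall_2)
  have "emeasure (lborel \<Otimes>\<^sub>M lborel) ({l $ 1<..<u $ 1} \<times> {l $ 2<..<u $ 2})
      = ennreal (u $ 1 - l $ 1) * ennreal (u $ 2 - l $ 2)"
    using le' by (subst lborel.emeasure_pair_measure_Times) auto
  then show "emeasure (distr (lborel \<Otimes>\<^sub>M lborel) borel (\<lambda>(s, t). vector [s, t])) (box l u)
      = ennreal (\<Prod>b\<in>Basis. (u - l) \<bullet> b)"
    using le' by (subst emeasure_distr[OF meas])
      (auto simp: pre space_pair_measure prod_Basis_vec2 ennreal_mult)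
qed simp

text \<open>reference\<close>
definition std_triangle :: "(real ^ 2) set" where
  "std_triangle = {x. 0 \<le> x $ 1 \<and> 0 \<le> x $ 2 \<and> x $ 1 + x $ 2 \<le> 1}"

lemma compact_std_triangle: "compact std_triangle"
proof -
  have "closed std_triangle" unfolding std_triangle_def
    by (intro closed_Collect_conj closed_Collect_le continuous_intros)
  moreover have "std_triangle \<subseteq> cbox 0 1"
    by (auto simp: std_triangle_def mem_box_cart forall_2)
  ultimately show ?thesis
    using bounded_cbox bounded_subset compact_eq_bounded_closed by blast
qed

text \<open>The right-hand side is the area \<open>1 / 2\<close> times the mean over the three edge midpoints: the midpoint
  rule is exact for quadratic polynomials.\<close>

lemma integral_std_triangle_affine_square:
  "integral std_triangle (\<lambda>x. (a + b * x $ 1 + c * x $ 2)\<^sup>2)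
    = ((a + b / 2)\<^sup>2 + (a + c / 2)\<^sup>2 + (a + b / 2 + c / 2)\<^sup>2) / 6"
proof -
  define f :: "real ^ 2 \<Rightarrow> real" where "f x = (a + b * x $ 1 + c * x $ 2)\<^sup>2" for x
  define h where "h x = indicator std_triangle x * f x" for x
  have cont: "continuous_on A f" for A
    unfolding f_def by (intro continuous_intros)
  have int: "integrable lborel h"
    using borel_integrable_compact[OF compact_std_triangle cont] by (simp add: h_def[abs_def])
  have "integral std_triangle f = (\<integral>x. h x \<partial>lborel)"
  proof -
    have "set_integrable lborel std_triangle f" using int
      by (simp add: set_integrable_def h_def[abs_def])
    from set_borel_integral_eq_integral(2)[OF this] show ?thesis
      by (simp add: set_lebesgue_integral_def h_def[abs_def])
  qed
  also have "\<dots> = (\<integral>p. h (case p of (s, t) \<Rightarrow> vector [s, t]) \<partial>(lborel \<Otimes>\<^sub>M lborel))"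
  proof (subst (1) lborel_vec2, rule integral_distr)
    show "(\<lambda>(s, t). vector [s, t] :: real ^ 2) \<in> (lborel \<Otimes>\<^sub>M lborel) \<rightarrow>\<^sub>M borel"
      using borel_measurable_vector2 by (simp add: lborel_prod)
    show "h \<in> borel_measurable borel" using int by simp
  qed
  also have "\<dots> = (\<integral>s. \<integral>t. h (vector [s, t]) \<partial>lborel \<partial>lborel)"
  proof -
    have "integrable (distr (lborel \<Otimes>\<^sub>M lborel) borel (\<lambda>(s, t). vector [s, t])) h"
      using int by (simp flip: lborel_vec2)
    then have "integrable (lborel \<Otimes>\<^sub>M lborel) (\<lambda>(s, t). h (vector [s, t]))"
      using borel_measurable_vector2 int
      by (subst (asm) integrable_distr_eq) (simp_all add: lborel_prod case_prod_unfold)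
    from lborel_pair.integral_fst[OF this] show ?thesis by (simp add: case_prod_unfold)
  qed
  also have "\<dots> = (\<integral>s. indicator {0..1} s * (\<integral>t. indicator {0..1 - s} t * (a + b * s + c * t)\<^sup>2 \<partial>lborel) \<partial>lborel)"
  proof (rule Bochner_Integration.integral_cong[OF refl])
    fix s :: real
    have "h (vector [s, t]) = indicator {0..1} s * (indicator {0..1 - s} t * (a + b * s + c * t)\<^sup>2)" for t
      by (auto simp: h_def f_def std_triangle_def indicator_def)
    then show "(\<integral>t. h (vector [s, t]) \<partial>lborel)
        = indicator {0..1} s * (\<integral>t. indicator {0..1 - s} t * (a + b * s + c * t)\<^sup>2 \<partial>lborel)"
      by simp
  qed
  also have "\<dots> = (\<integral>s. indicator {0..1} s *\<^sub>R
      ((a + b * s)\<^sup>2 * (1 - s) + (a + b * s) * c * (1 - s)\<^sup>2 + c\<^sup>2 * (1 - s) ^ 3 / 3) \<partial>lborel)"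
  proof (rule Bochner_Integration.integral_cong[OF refl])
    fix s :: real
    let ?F = "\<lambda>t. (a + b * s)\<^sup>2 * t + (a + b * s) * c * t\<^sup>2 + c\<^sup>2 * t ^ 3 / 3"
    have "(\<integral>t. indicator {0..1 - s} t *\<^sub>R (a + b * s + c * t)\<^sup>2 \<partial>lborel) = ?F (1 - s) - ?F 0" if "s \<le> 1"
      using that
    proof (intro integral_FTC_atLeastAtMost)
      fix t :: real
      have "(?F has_real_derivative (a + b * s + c * t)\<^sup>2) (at t)"
        by (auto intro!: derivative_eq_intros simp: algebra_simps power2_eq_square power3_eq_cube)
      then show "(?F has_vector_derivative (a + b * s + c * t)\<^sup>2) (at t within {0..1 - s})"
        by (simp add: has_real_derivative_iff_has_vector_derivative has_vector_derivative_at_within)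
    qed (auto intro!: continuous_intros)
    then show "indicator {0..1} s * (\<integral>t. indicator {0..1 - s} t * (a + b * s + c * t)\<^sup>2 \<partial>lborel)
      = indicator {0..1} s *\<^sub>R ((a + b * s)\<^sup>2 * (1 - s) + (a + b * s) * c * (1 - s)\<^sup>2 + c\<^sup>2 * (1 - s) ^ 3 / 3)"
      by (auto simp: indicator_def)
  qed
  also have "\<dots> = ((a + b / 2)\<^sup>2 + (a + c / 2)\<^sup>2 + (a + b / 2 + c / 2)\<^sup>2) / 6"
  proof -
    \<comment> \<open>Antiderivative found by expanding the integrand in powers of \<open>1 - s\<close>.\<close>
    let ?G = "\<lambda>s. - ((a + b)\<^sup>2 * (1 - s)\<^sup>2 / 2 + (a + b) * (c - 2 * b) * (1 - s) ^ 3 / 3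
      + (b\<^sup>2 - b * c) * (1 - s) ^ 4 / 4 + c\<^sup>2 * (1 - s) ^ 4 / 12)"
    have "(\<integral>s. indicator {0..1} s *\<^sub>R
      ((a + b * s)\<^sup>2 * (1 - s) + (a + b * s) * c * (1 - s)\<^sup>2 + c\<^sup>2 * (1 - s) ^ 3 / 3) \<partial>lborel) = ?G 1 - ?G 0"
    proof (intro integral_FTC_atLeastAtMost)
      fix s :: real
      have "(?G has_real_derivative ((a + b * s)\<^sup>2 * (1 - s) + (a + b * s) * c * (1 - s)\<^sup>2
            + c\<^sup>2 * (1 - s) ^ 3 / 3)) (at s)"
        by (auto intro!: derivative_eq_intros simp: field_simps power2_eq_square power3_eq_cube)
      then show "(?G has_vector_derivative ((a + b * s)\<^sup>2 * (1 - s) + (a + b * s) * c * (1 - s)\<^sup>2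
            + c\<^sup>2 * (1 - s) ^ 3 / 3)) (at s within {0..1})"
        by (simp add: has_real_derivative_iff_has_vector_derivative has_vector_derivative_at_within)
    qed (auto intro!: continuous_intros)
    then show ?thesis by (simp add: field_simps power2_eq_square)
  qed
  finally show ?thesis by (simp only: f_def[abs_def])
qed

text \<open>The affine map from the standard triangle to the cell has the constant Jacobian determinant
  \<open>orientation K\<close>.\<close>

lemma integral_region:
  fixes f :: "real ^ 2 \<Rightarrow> real"
  assumes K: "orientation K \<noteq> 0" and f: "continuous_on UNIV f"
  shows "integral (region K) f = \<bar>orientation K\<bar> *
    integral std_triangle (\<lambda>x. f (K $ 1 + x $ 1 *\<^sub>R (K $ 2 - K $ 1) + x $ 2 *\<^sub>R (K $ 3 - K $ 1)))"
proof -
  define g where "g x = K $ 1 + x $ 1 *\<^sub>R (K $ 2 - K $ 1) + x $ 2 *\<^sub>R (K $ 3 - K $ 1)" for x :: "real ^ 2"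
  define g' where "g' h = h $ 1 *\<^sub>R (K $ 2 - K $ 1) + h $ 2 *\<^sub>R (K $ 3 - K $ 1)" for h :: "real ^ 2"
  \<comment> \<open>Values in \<open>real ^ 1\<close>, as in the theorem \<open>integral_change_of_variables\<close>.\<close>
  define F :: "real ^ 2 \<Rightarrow> real ^ 1" where "F x = vec (f x)" for x
  have image: "region K = g ` std_triangle"
  proof
    show "region K \<subseteq> g ` std_triangle"
    proof
      fix y assume "y \<in> region K"
      then obtain s t where st: "0 \<le> s" "0 \<le> t" "s + t \<le> 1"
        "y = K $ 1 + s *\<^sub>R (K $ 2 - K $ 1) + t *\<^sub>R (K $ 3 - K $ 1)"
        by (auto simp: region_eq convex_hull_3_alt)
      then have "y = g (vector [s, t])" "vector [s, t] \<in> std_triangle"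
        by (auto simp: g_def std_triangle_def)
      then show "y \<in> g ` std_triangle" by blast
    qed
    show "g ` std_triangle \<subseteq> region K"
      by (auto simp: region_eq convex_hull_3_alt g_def std_triangle_def)
  qed
  have der: "(g has_derivative g') (at x within S)" for x S
  proof -
    have [derivative_intros]: "((\<lambda>x. x $ i) has_derivative (\<lambda>h. h $ i)) (at x within S)" for i and x :: "real ^ 2"
      by (intro bounded_linear_imp_has_derivative bounded_linear_vec_nth)
    show ?thesis unfolding g_def[abs_def] g'_def[abs_def]
      by (auto intro!: derivative_eq_intros)
  qed
  have det: "\<bar>det (matrix g')\<bar> = \<bar>orientation K\<bar>"
    by (simp add: det_2 matrix_def g'_def axis_def orientation_def algebra_simps)
  have inj: "inj_on g std_triangle"
  proof (rule inj_onI)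
    fix x y assume "g x = g y"
    define p q where "p = x $ 1 - y $ 1" and "q = x $ 2 - y $ 2"
    have "p *\<^sub>R (K $ 2 - K $ 1) + q *\<^sub>R (K $ 3 - K $ 1) = 0"
      using \<open>g x = g y\<close> by (simp add: g_def p_def q_def algebra_simps)
    then have e: "p * (K $ 2 - K $ 1) $ 1 + q * (K $ 3 - K $ 1) $ 1 = 0"
      "p * (K $ 2 - K $ 1) $ 2 + q * (K $ 3 - K $ 1) $ 2 = 0"
      by (simp_all add: vec_eq_iff forall_2)
    then have "p * orientation K = 0" unfolding orientation_def by algebra
    moreover have "q * orientation K = 0" using e unfolding orientation_def by algebra
    ultimately show "x = y" using K by (simp add: p_def q_def vec_eq_iff forall_2)
  qed
  have contF: "continuous_on S (\<lambda>x. F (g x))" for S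
  proof -
    have "continuous_on S g" unfolding g_def by (intro continuous_intros)
    then have "continuous_on S (\<lambda>x. f (g x))"
      by (rule continuous_on_compose2[OF f]) simp
    then show ?thesis unfolding F_def vec_def by (intro continuous_on_vec_lambda)
  qed
  have "integral (g ` std_triangle) F = integral std_triangle (\<lambda>x. \<bar>det (matrix g')\<bar> *\<^sub>R F (g x))"
  proof (rule integral_change_of_variables)
    show "std_triangle \<in> sets lebesgue"
      by (simp add: compact_std_triangle lmeasurable_compact fmeasurableD)
    show "(g has_derivative g') (at x within std_triangle)" for x by (rule der)
    show "inj_on g std_triangle" by (rule inj)
    have "(\<lambda>x. \<bar>det (matrix g')\<bar> *\<^sub>R F (g x)) absolutely_integrable_on std_triangle"
      using borel_integrable_compact[OF compact_std_triangle, of "\<lambda>x. \<bar>det (matrix g')\<bar> *\<^sub>R F (g x)"] contF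
      by (simp add: set_integrable_def continuous_on_scaleR integrable_completion
          borel_measurable_integrable)
    then show "F absolutely_integrable_on g ` std_triangle \<or>
      (\<lambda>x. \<bar>det (matrix g')\<bar> *\<^sub>R F (g x)) absolutely_integrable_on std_triangle" ..
  qed
  then show ?thesis
    unfolding image integral_on_1_eq det by (simp add: F_def vec_eq_iff g_def)
qed

lemma cell_avg_affine_square:
  fixes q :: "real ^ 2 \<Rightarrow> real"
  assumes K: "orientation K \<noteq> 0" and q: "\<And>x. q x = c0 + c1 * x $ 1 + c2 * x $ 2"
  shows "cell_avg K (\<lambda>x. (q x)\<^sup>2) = (\<Sum>i\<in>UNIV. (q (edge_point K i (1 / 2)))\<^sup>2) / 3"
proof -
  have qg: "q (K $ 1 + x $ 1 *\<^sub>R (K $ 2 - K $ 1) + x $ 2 *\<^sub>R (K $ 3 - K $ 1))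
      = q (K $ 1) + (q (K $ 2) - q (K $ 1)) * x $ 1 + (q (K $ 3) - q (K $ 1)) * x $ 2" for x :: "real ^ 2"
    by (simp add: q algebra_simps)
  have mid: "q (edge_point K i (1 / 2)) = (q (K $ i) + q (K $ (i + 1))) / 2" for i
    by (simp add: q edge_point_def field_simps)
  have "continuous_on UNIV (\<lambda>x. (q x)\<^sup>2)" unfolding q by (intro continuous_intros)
  from integral_region[OF K this] show ?thesis
    using K unfolding qg integral_std_triangle_affine_square mid
    by (simp add: cell_avg_def area_eq sum_3 field_simps power2_eq_square)
qed

lemma edge_integral_affine_square:
  fixes q :: "real ^ 2 \<Rightarrow> real"
  assumes q: "\<And>x. q x = c0 + c1 * x $ 1 + c2 * x $ 2"
  shows "edge_integral K i (\<lambda>x. (q x)\<^sup>2)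
    = edge_len K i * ((q (K $ i))\<^sup>2 + q (K $ i) * q (K $ (i + 1)) + (q (K $ (i + 1)))\<^sup>2) / 3"
proof -
  define a b where "a = q (K $ i)" and "b = q (K $ (i + 1))"
  have qe: "q (edge_point K i t) = a + (b - a) * t" for t
    by (simp add: q edge_point_def a_def b_def algebra_simps)
  let ?F = "\<lambda>t. a\<^sup>2 * t + a * (b - a) * t\<^sup>2 + (b - a)\<^sup>2 * t ^ 3 / 3"
  have "((\<lambda>t. (a + (b - a) * t)\<^sup>2) has_integral ?F 1 - ?F 0) {0..1}"
  proof (rule fundamental_theorem_of_calculus)
    fix t :: real
    have "(?F has_real_derivative (a + (b - a) * t)\<^sup>2) (at t within {0..1})"
      by (auto intro!: derivative_eq_intros simp: field_simps power2_eq_square power3_eq_cube)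
    then show "(?F has_vector_derivative (a + (b - a) * t)\<^sup>2) (at t within {0..1})"
      by (simp add: has_real_derivative_iff_has_vector_derivative)
  qed simp
  then have "integral {0..1} (\<lambda>t. (a + (b - a) * t)\<^sup>2) = (a\<^sup>2 + a * b + b\<^sup>2) / 3"
    by (simp add: integral_unique field_simps power2_eq_square)
  then show ?thesis
    by (simp add: edge_integral_def qe flip: a_def b_def)
qed

text \<open>Cramer's rule.\<close>

lemma affine_interpolation:
  assumes K: "orientation K \<noteq> 0"
  obtains c0 c1 c2 :: real where "\<And>i. c0 + c1 * K $ i $ 1 + c2 * K $ i $ 2 = a i"
proof
  define D where "D = orientation K"
  define c1 where "c1 = ((a 2 - a 1) * (K $ 3 - K $ 1) $ 2 - (a 3 - a 1) * (K $ 2 - K $ 1) $ 2) / D"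
  define c2 where "c2 = ((a 3 - a 1) * (K $ 2 - K $ 1) $ 1 - (a 2 - a 1) * (K $ 3 - K $ 1) $ 1) / D"
  have D: "D \<noteq> 0" using K by (simp add: D_def)
  have "c1 * (K $ 2 - K $ 1) $ 1 + c2 * (K $ 2 - K $ 1) $ 2 = ((a 2 - a 1) * orientation K) / D"
    unfolding c1_def c2_def orientation_def by (simp add: add_divide_distrib[symmetric] del: vector_minus_component) algebra
  moreover have "c1 * (K $ 3 - K $ 1) $ 1 + c2 * (K $ 3 - K $ 1) $ 2 = ((a 3 - a 1) * orientation K) / D"
    unfolding c1_def c2_def orientation_def by (simp add: add_divide_distrib[symmetric] del: vector_minus_component) algebra
  ultimately have "c1 * (K $ 2 - K $ 1) $ 1 + c2 * (K $ 2 - K $ 1) $ 2 = a 2 - a 1"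
    "c1 * (K $ 3 - K $ 1) $ 1 + c2 * (K $ 3 - K $ 1) $ 2 = a 3 - a 1"
    using D by (simp_all add: D_def)
  then show "(a 1 - c1 * K $ 1 $ 1 - c2 * K $ 1 $ 2) + c1 * K $ i $ 1 + c2 * K $ i $ 2 = a i" for i
    using exhaust_3[of i] by (auto simp: algebra_simps)
qed

lemma affine_square_in_polys:
  "(\<lambda>x :: real ^ 2. (c0 + c1 * x $ 1 + c2 * x $ 2)\<^sup>2) \<in> polys 2"
proof -
  define c :: "nat \<Rightarrow> nat \<Rightarrow> real" where "c a b =
    (if a = 0 \<and> b = 0 then c0\<^sup>2 else if a = 1 \<and> b = 0 then 2 * c0 * c1 else if a = 0 \<and> b = 1 then 2 * c0 * c2
     else if a = 2 then c1\<^sup>2 else if b = 2 then c2\<^sup>2 else 2 * c1 * c2)" for a b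
  have "(c0 + c1 * x $ 1 + c2 * x $ 2)\<^sup>2 = (\<Sum>a\<le>2. \<Sum>b\<le>2 - a. (x $ 1 ^ a * x $ 2 ^ b) *\<^sub>R c a b)" for x :: "real ^ 2"
    by (simp add: numeral_2_eq_2 c_def power2_eq_square algebra_simps)
  then show ?thesis unfolding polys_def by blast
qed

text \<open>Write \<open>x, y, z\<close> for the edge lengths and \<open>P\<close> for their sum. The quadratic form in question is
  \<open>P |m|\<^sup>2 + m \<bullet> A m\<close> where \<open>A\<close> has the rows \<open>(2x, -z, -y)\<close>, \<open>(-z, 2y, -x)\<close> and \<open>(-y, -x, 2z)\<close>. The
  eigenvalues of \<open>A\<close> are \<open>P\<close> and the roots of
  \<open>t\<^sup>2 = P t + 2 (x\<^sup>2 + y\<^sup>2 + z\<^sup>2 - x y - y z - z x)\<close>, whose larger root is \<open>\<mu> = (P + 3 l_hat) / 2\<close>. As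
  \<open>P + \<mu> = 1 / C\<close>, an eigenvector of \<open>A\<close> for \<open>\<mu>\<close> has the required property.\<close>

lemma extremal_midpoint_values:
  assumes K: "orientation K \<noteq> 0"
  obtains m :: "3 \<Rightarrow> real" where "0 < (\<Sum>i\<in>UNIV. (m i)\<^sup>2)"
    and "cfl_const K * (\<Sum>i\<in>UNIV. edge_len K i * (3 * (m i)\<^sup>2 + (m (i + 1) - m (i + 2))\<^sup>2)) = (\<Sum>i\<in>UNIV. (m i)\<^sup>2)"
proof -
  define x y z where "x = edge_len K 1" and "y = edge_len K 2" and "z = edge_len K 3"
  define P where "P = x + y + z"
  define \<mu> where "\<mu> = (P + 3 * l_hat K) / 2"
  have pos: "0 < x" "0 < y" "0 < z" using edge_len_pos[OF K] by (simp_all add: x_def y_def z_def)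
  have P\<mu>: "0 < P + \<mu>" using pos l_hat_nonneg[of K] by (simp add: P_def \<mu>_def add_pos_nonneg)
  have C: "cfl_const K = 1 / (P + \<mu>)"
  proof -
    have "9 * l_bar K + 3 * l_hat K = 2 * (P + \<mu>)"
      by (simp add: l_bar_def sum_3 P_def \<mu>_def x_def y_def z_def field_simps)
    then show ?thesis using P\<mu> by (simp add: cfl_const_def field_simps)
  qed
  have lh: "(l_hat K)\<^sup>2 = x\<^sup>2 + y\<^sup>2 + z\<^sup>2 - 2 / 3 * (x * y + y * z + z * x)"
    unfolding l_hat_square by (simp add: sum_3 x_def y_def z_def)
  have char: "\<mu>\<^sup>2 = P * \<mu> + 2 * (x\<^sup>2 + y\<^sup>2 + z\<^sup>2 - x * y - y * z - z * x)"
  proof -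
    have "\<mu>\<^sup>2 - P * \<mu> = (9 * (l_hat K)\<^sup>2 - P\<^sup>2) / 4"
      by (simp add: \<mu>_def power2_eq_square field_simps)
    then show ?thesis unfolding lh by (simp add: P_def power2_eq_square field_simps)
  qed
  have "\<exists>p q r. p\<^sup>2 + q\<^sup>2 + r\<^sup>2 > 0 \<and> 2 * x * p - z * q - y * r = \<mu> * p
      \<and> 2 * y * q - z * p - x * r = \<mu> * q \<and> 2 * z * r - y * p - x * q = \<mu> * r"
  proof (cases "x = y \<and> y = z")
    \<comment> \<open>For an equilateral cell the eigenvalue is double and the vector used otherwise is zero.\<close>
    case True
    then have "(l_hat K)\<^sup>2 = x\<^sup>2" unfolding lh by (simp add: power2_eq_square)
    then have "l_hat K = x" using pos l_hat_nonneg[of K] by (simp add: power2_eq_iff_nonneg)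
    then have "\<mu> = 3 * x" using True by (simp add: \<mu>_def P_def)
    then show ?thesis
      using True by (intro exI[of _ 1] exI[of _ "- 1"] exI[of _ 0]) auto
  next
    case False
    \<comment> \<open>The matrix leaves the span of \<open>(1, 1, 1)\<close> and \<open>(x, y, z)\<close> invariant; this is the eigenvector for \<open>\<mu>\<close> in it.\<close>
    define p q r where "p = 3 * x + \<mu> - 2 * P" and "q = 3 * y + \<mu> - 2 * P" and "r = 3 * z + \<mu> - 2 * P"
    have "\<not> (p = 0 \<and> q = 0 \<and> r = 0)" using False by (auto simp: p_def q_def r_def)
    then have "p\<^sup>2 + q\<^sup>2 + r\<^sup>2 > 0"
      using sum_power2_gt_zero_iff[of p q] by (cases "r = 0") (auto intro: add_nonneg_pos)
    moreover have "2 * x * p - z * q - y * r = \<mu> * p" "2 * y * q - z * p - x * r = \<mu> * q"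
      "2 * z * r - y * p - x * q = \<mu> * r"
      using char unfolding p_def q_def r_def P_def by algebra+
    ultimately show ?thesis by blast
  qed
  then obtain p q r where nz: "p\<^sup>2 + q\<^sup>2 + r\<^sup>2 > 0" and eig: "2 * x * p - z * q - y * r = \<mu> * p"
      "2 * y * q - z * p - x * r = \<mu> * q" "2 * z * r - y * p - x * q = \<mu> * r" by blast
  define m :: "3 \<Rightarrow> real" where "m = (\<lambda>i. if i = 1 then p else if i = 2 then q else r)"
  have m: "m 1 = p" "m 2 = q" "m 3 = r" by (simp_all add: m_def)
  have "(\<Sum>i\<in>UNIV. edge_len K i * (3 * (m i)\<^sup>2 + (m (i + 1) - m (i + 2))\<^sup>2))
      = P * (p\<^sup>2 + q\<^sup>2 + r\<^sup>2) + p * (2 * x * p - z * q - y * r) + q * (2 * y * q - z * p - x * r)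
        + r * (2 * z * r - y * p - x * q)"
    by (simp add: sum_3 m P_def flip: x_def y_def z_def) (simp add: power2_eq_square algebra_simps)
  also have "\<dots> = (P + \<mu>) * (p\<^sup>2 + q\<^sup>2 + r\<^sup>2)"
    unfolding eig by (simp add: power2_eq_square algebra_simps)
  finally have "cfl_const K * (\<Sum>i\<in>UNIV. edge_len K i * (3 * (m i)\<^sup>2 + (m (i + 1) - m (i + 2))\<^sup>2))
      = (\<Sum>i\<in>UNIV. (m i)\<^sup>2)"
    using P\<mu> by (simp add: C sum_3 m)
  with that[of m] nz show ?thesis by (simp add: sum_3 m)
qed

text \<open>The test polynomial is the square of the affine function that takes the extremal values at the edge
  midpoints. An affine function with the midpoint values \<open>m\<close> has the value
  \<open>m\<^sub>i + m\<^sub>i\<^sub>+\<^sub>2 - m\<^sub>i\<^sub>+\<^sub>1\<close> at the vertex \<open>i\<close>, which is shared by the edges \<open>i\<close> and \<open>i + 2\<close>.\<close>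

lemma feasible_edge_weight_bound:
  assumes K: "orientation K \<noteq> 0" and feas: "feasible_decomposition 2 K w S \<omega> \<xi>"
  shows "Min (range (\<lambda>i. w i / edge_len K i)) \<le> cfl_const K"
proof -
  obtain m where m: "0 < (\<Sum>i\<in>UNIV. (m i)\<^sup>2)"
    "cfl_const K * (\<Sum>i\<in>UNIV. edge_len K i * (3 * (m i)\<^sup>2 + (m (i + 1) - m (i + 2))\<^sup>2)) = (\<Sum>i\<in>UNIV. (m i)\<^sup>2)"
    by (rule extremal_midpoint_values[OF K])
  define E where "E i = edge_len K i * (3 * (m i)\<^sup>2 + (m (i + 1) - m (i + 2))\<^sup>2)" for i
  obtain c0 c1 c2 where c: "\<And>i. c0 + c1 * K $ i $ 1 + c2 * K $ i $ 2 = m i + m (i + 2) - m (i + 1)"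
    using affine_interpolation[OF K, of "\<lambda>i. m i + m (i + 2) - m (i + 1)"] by blast
  define q where "q x = c0 + c1 * x $ 1 + c2 * x $ 2" for x :: "real ^ 2"
  have qK: "q (K $ i) = m i + m (i + 2) - m (i + 1)" for i by (simp add: q_def c)
  have qK1: "q (K $ (i + 1)) = m (i + 1) + m i - m (i + 2)" for i
    unfolding qK using exhaust_3[of i] by auto
  have mid: "q (edge_point K i (1 / 2)) = m i" for i
  proof -
    have "q (edge_point K i (1 / 2)) = (q (K $ i) + q (K $ (i + 1))) / 2"
      by (simp add: q_def edge_point_def field_simps)
    then show ?thesis unfolding qK1 qK[of i] by simp
  qed
  have avg: "cell_avg K (\<lambda>x. (q x)\<^sup>2) = cfl_const K * ((\<Sum>i\<in>UNIV. E i) / 3)"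
    using cell_avg_affine_square[OF K q_def] m(2) by (simp add: mid E_def)
  have edge: "edge_integral K i (\<lambda>x. (q x)\<^sup>2) = E i / 3" for i
    unfolding edge_integral_affine_square[OF q_def] qK1 qK[of i] E_def
    by (simp add: power2_eq_square algebra_simps)
  have E_nonneg: "0 \<le> E i" for i
    using edge_len_pos[OF K, of i] by (simp add: E_def)
  define \<mu> where "\<mu> = Min (range (\<lambda>i. w i / edge_len K i))"
  have \<mu>: "\<mu> \<le> w i / edge_len K i" for i by (simp add: \<mu>_def)
  have "\<mu> * ((\<Sum>i\<in>UNIV. E i) / 3) = (\<Sum>i\<in>UNIV. \<mu> * (E i / 3))"
    by (simp add: sum_distrib_left sum_divide_distrib)
  also have "\<dots> \<le> (\<Sum>i\<in>UNIV. w i / edge_len K i * (E i / 3))"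
    by (intro sum_mono mult_right_mono \<mu>) (simp add: E_nonneg)
  also have "\<dots> \<le> \<dots> + (\<Sum>s<S. \<omega> s * (q (\<xi> s))\<^sup>2)"
    using feas by (auto simp: feasible_decomposition_def less_imp_le intro!: sum_nonneg mult_nonneg_nonneg)
  also have "\<dots> = cell_avg K (\<lambda>x. (q x)\<^sup>2)"
    using feas affine_square_in_polys[of c0 c1 c2]
    by (simp add: feasible_decomposition_def edge mult.commute[of 3] flip: q_def)
  finally have "\<mu> * ((\<Sum>i\<in>UNIV. E i) / 3) \<le> cfl_const K * ((\<Sum>i\<in>UNIV. E i) / 3)"
    by (simp add: avg)
  moreover have "0 < (\<Sum>i\<in>UNIV. E i) / 3"
  proof -
    have "(\<Sum>i\<in>UNIV. E i) \<noteq> 0" using m by (auto simp flip: E_def)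
    then show ?thesis using sum_nonneg[of UNIV E] E_nonneg by fastforce
  qed
  ultimately show ?thesis by (simp add: \<mu>_def)
qed

theorem corollary4p2:
  fixes \<T> :: "cell set" and \<Omega> :: "(real ^ 2) set"
  assumes mesh: "mesh_of \<T> \<Omega>"
  shows
    "(\<forall>(f1 :: real ^ 'd \<Rightarrow> real ^ 'd) f2 (J :: 'j set) J' g a u ub \<alpha> \<Delta>t.
        hyperbolic_on (region_of J J' g) f1 f2 \<and> gql_representable J J' g \<and>
        weak_LF J J' g f1 f2 a \<and>
        (\<forall>K\<in>\<T>. u K \<in> polys 2) \<and> states_in (region_of J J' g) \<T> u ub \<and>
        alpha_wLF \<T> a u ub \<le> ereal \<alpha> \<and> 0 < \<Delta>t \<and> cfl \<T> \<alpha> \<Delta>t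
        \<longrightarrow> (\<forall>K\<in>\<T>. next_avg \<T> f1 f2 \<alpha> \<Delta>t u ub K \<in> region_of J J' g))
     \<and>
     (\<forall>(f1 :: real \<Rightarrow> real) f2 u0 u_min u_max u ub \<alpha> \<Delta>t.
        (\<forall>v. f1 field_differentiable (at v) \<and> f2 field_differentiable (at v)) \<and>
        extrema_on \<Omega> u0 u_min u_max \<and>
        (\<forall>K\<in>\<T>. u K \<in> polys 2) \<and> states_in {u_min..u_max} \<T> u ub \<and>
        alpha_LF \<T> f1 f2 u ub \<le> ereal \<alpha> \<and> 0 < \<Delta>t \<and> cfl \<T> \<alpha> \<Delta>t
        \<longrightarrow> (\<forall>K\<in>\<T>. next_avg \<T> f1 f2 \<alpha> \<Delta>t u ub K \<in> {u_min..u_max}))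
     \<and>
     (\<forall>K\<in>\<T>. \<forall>w S \<omega> \<xi>. feasible_decomposition 2 K w S \<omega> \<xi>
        \<longrightarrow> Min (range (\<lambda>i. w i / edge_len K i)) \<le> cfl_const K)"
proof (intro conjI allI impI ballI; (elim conjE)?)
  fix f1 f2 :: "real ^ 'd \<Rightarrow> real ^ 'd" and J J' :: "'j set" and g a u ub \<alpha> \<Delta>t K
  assume "K \<in> \<T>" "gql_representable J J' g" "weak_LF J J' g f1 f2 a"
    "states_in (region_of J J' g) \<T> u ub" "alpha_wLF \<T> a u ub \<le> ereal \<alpha>" "0 < \<Delta>t" "cfl \<T> \<alpha> \<Delta>t"
  then show "next_avg \<T> f1 f2 \<alpha> \<Delta>t u ub K \<in> region_of J J' g"
    by (intro system_bound_preserving[OF mesh]) simp_all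
next
  fix f1 f2 :: "real \<Rightarrow> real" and u_min u_max u ub \<alpha> \<Delta>t K
  assume "K \<in> \<T>" "\<forall>v. f1 field_differentiable (at v) \<and> f2 field_differentiable (at v)"
    "states_in {u_min..u_max} \<T> u ub" "alpha_LF \<T> f1 f2 u ub \<le> ereal \<alpha>" "0 < \<Delta>t" "cfl \<T> \<alpha> \<Delta>t"
  then show "next_avg \<T> f1 f2 \<alpha> \<Delta>t u ub K \<in> {u_min..u_max}"
    by (intro scalar_bound_preserving[OF mesh]) auto
next
  fix K w S \<omega> \<xi>
  assume "K \<in> \<T>" "feasible_decomposition 2 K w S \<omega> \<xi>"
  then show "Min (range (\<lambda>i. w i / edge_len K i)) \<le> cfl_const K"
    using mesh_cell_orientation[OF mesh] feasible_edge_weight_bound by blast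
qed

end
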